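(* Suppose the polyhedron $P$ is in general position, with bounding half-spaces $H_1,\dots,H_n$, and is bounded. Then, for every $J\in\mathcal F$, $$ g^J(\tilde a,0)= \begin{cases} \dfrac{1}{(2\pi)^{d/2}\sqrt{|\alpha_J(\tilde a)|}} & (|J|=d),\\[2mm] 0 & (|J|\neq d). \end{cases} $$
   Context: Let $d,n\ge 1$, $[n]=\{1,\dots,n\}$, and let $\tilde a=(\tilde a_{ij})\in\mathbf R^{d\times n}$, $\tilde b=(\tilde b_1,\dots,\tilde b_n)^\top\in\mathbf R^n$. Set $H_j=\{x\in\mathbf R^d:\sum_{i=1}^d\tilde a_{ij}x_i+\tilde b_j\ge 0\}$ for $1\le j\le n$ and $P=\bigcap_{j=1}^nH_j$. Bounding half-spaces: $H_1,\dots,H_n$ are the bounding half-spaces of $P$ if $P$ has nonempty interior, every column of $\tilde a$ is nonzero, and the sets $F_j=P\cap\{x:\sum_{i}\tilde a_{ij}x_i+\tilde b_j=0\}$, $1\le j\le n$, are pairwise distinct and are exactly the facets of $P$. General position: put $\hat f_0(x_0,x)=x_0$ and $\hat f_j(x_0,x)=\sum_{i=1}^d\tilde a_{ij}x_i+\tilde b_jx_0$ $(1\le j\le n)$ for $(x_0,x)\in\mathbf R\times\mathbf R^d$, and let $\hat P=\{(x_0,x):\hat f_j(x_0,x)\ge0,\ 0\le j\le n\}$. With $H_1,\dots,H_n$ the bounding half-spaces of $P$, the polyhedron $P$ is in general position if for every $J\subset\{0,1,\dots,n\}$ such that some nonzero point of $\hat P$ satisfies $\hat f_j=0$ for all $j\in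 J$, the linear forms $\hat f_j$ $(j\in J)$ are linearly independent. $\mathcal F=\{J\subset[n]:\bigcap_{j\in J}F_j\neq\emptyset\}$ (with $\emptyset\in\mathcal F$) is the abstract simplicial complex associated with $P$. $H:\mathbf R\to\mathbf R$ is the Heaviside function, $H(x)=1$ for $x\ge0$ and $H(x)=0$ for $x<0$. For $a=(a_{ij})\in\mathbf R^{d\times n}$, $b\in\mathbf R^n$, $x\in\mathbf R^d$, put $f_j(a,b,x)=\sum_{i=1}^da_{ij}x_i+b_j$ and $$ \varphi(a,b)=\int_{\mathbf R^d}\frac{1}{(2\pi)^{d/2}}\exp\Bigl(-\frac12\sum_{i=1}^dx_i^2\Bigr)\sum_{F\in\mathcal F}\prod_{j\in F}\bigl(H(f_j(a,b,x))-1\bigr)\,dx , $$ where $\mathcal F$ is the fixed complex of $P$ (i.e. of $(\tilde a,\tilde b)$). For $J\in\mathcal F$, $g^J(a,b)=\bigl(\prod_{j\in J}\frac{\partial}{\partial b_j}\bigr)\varphi(a,b)$; thus $g^J(\tilde a,0)$ is this partial derivative in $b$ evaluated at $a=\tilde a$, $b=0$. Moreover $\alpha_J(a)=\bigl(\sum_{k=1}^da_{ki}a_{kj}\bigr)_{i,j\in J}$ and $|\alpha_J(a)|$ is its determinant. *)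

theory Defs
  imports "HOL-Analysis.Analysis"
begin

text \<open>
  A \<open>d \<times> n\<close> matrix is an element of \<open>real^'n^'d\<close>, so that \<open>a $ i $ j\<close> is the entry in row \<open>i\<close>
  and column \<open>j\<close>. Since index types are nonempty, \<open>d \<ge> 1\<close> and \<open>n \<ge> 1\<close> are built in.
\<close>

definition aff_form :: "real^'n^'d \<Rightarrow> real^'n \<Rightarrow> 'n \<Rightarrow> real^'d \<Rightarrow> real" where
  "aff_form a b j x = (\<Sum>i\<in>UNIV. a $ i $ j * x $ i) + b $ j"

definition half_space :: "real^'n^'d \<Rightarrow> real^'n \<Rightarrow> 'n \<Rightarrow> (real^'d) set" where
  "half_space a b j = {x. aff_form a b j x \<ge> 0}"

definition polyhedron_of :: "real^'n^'d \<Rightarrow> real^'n \<Rightarrow> (real^'d) set" where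
  "polyhedron_of a b = (\<Inter>j. half_space a b j)"

definition facet :: "real^'n^'d \<Rightarrow> real^'n \<Rightarrow> 'n \<Rightarrow> (real^'d) set" where
  "facet a b j = polyhedron_of a b \<inter> {x. aff_form a b j x = 0}"

definition bounding_half_spaces :: "real^'n^'d \<Rightarrow> real^'n \<Rightarrow> bool" where
  "bounding_half_spaces a b \<longleftrightarrow>
     interior (polyhedron_of a b) \<noteq> {} \<and>
     (\<forall>j. column j a \<noteq> 0) \<and>
     inj (facet a b) \<and>
     range (facet a b) = {F. F facet_of polyhedron_of a b}"

text \<open>The index set \<open>{0, 1, \<dots>, n}\<close> is \<open>'n option\<close>, with \<open>None\<close> in the role of \<open>0\<close>.\<close>

fun hom_form :: "real^'n^'d \<Rightarrow> real^'n \<Rightarrow> 'n option \<Rightarrow> real \<times> (real^'d) \<Rightarrow> real" where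
  "hom_form a b None (x0, x) = x0"
| "hom_form a b (Some j) (x0, x) = (\<Sum>i\<in>UNIV. a $ i $ j * x $ i) + b $ j * x0"

definition hom_polyhedron :: "real^'n^'d \<Rightarrow> real^'n \<Rightarrow> (real \<times> (real^'d)) set" where
  "hom_polyhedron a b = {p. \<forall>j. hom_form a b j p \<ge> 0}"

text \<open>
  Linear independence of a family of functions; as a family, so that a repeated function makes it
  dependent.
\<close>

definition independent_forms :: "'k set \<Rightarrow> ('k \<Rightarrow> 'v \<Rightarrow> real) \<Rightarrow> bool" where
  "independent_forms J f \<longleftrightarrow>
     (\<forall>c. (\<forall>p. (\<Sum>j\<in>J. c j * f j p) = 0) \<longrightarrow> (\<forall>j\<in>J. c j = 0))"

definition general_position :: "real^'n^'d \<Rightarrow> real^'n \<Rightarrow> bool" where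
  "general_position a b \<longleftrightarrow>
     (\<forall>J. (\<exists>p\<in>hom_polyhedron a b. p \<noteq> 0 \<and> (\<forall>j\<in>J. hom_form a b j p = 0)) \<longrightarrow>
          independent_forms J (hom_form a b))"

definition assoc_complex :: "real^'n^'d \<Rightarrow> real^'n \<Rightarrow> 'n set set" where
  "assoc_complex a b = {J. (\<Inter>j\<in>J. facet a b j) \<noteq> {}}"

definition heaviside :: "real \<Rightarrow> real" where
  "heaviside x = (if x \<ge> 0 then 1 else 0)"

definition phi :: "'n set set \<Rightarrow> real^'n^'d \<Rightarrow> real^'n \<Rightarrow> real" where
  "phi K a b =
     (\<integral>x. 1 / (2 * pi) powr (real CARD('d) / 2) * exp (- (1/2) * (\<Sum>i\<in>UNIV. (x $ i)\<^sup>2)) *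
          (\<Sum>F\<in>K. \<Prod>j\<in>F. (heaviside (aff_form a b j x) - 1)) \<partial>lborel)"

text \<open>
  \<open>has_iterated_partial [j\<^sub>1, \<dots>, j\<^sub>k] \<Phi> b D\<close>: the partial derivative
  \<open>\<partial>/\<partial>b\<^bsub>j\<^sub>1\<^esub> (\<partial>/\<partial>b\<^bsub>j\<^sub>2\<^esub> (\<dots> \<Phi>))\<close> exists at \<open>b\<close> and equals \<open>D\<close>; the inner derivatives are required
  to exist in a neighbourhood of \<open>b\<close>, where \<open>\<Psi>\<close> collects their values.
\<close>

primrec has_iterated_partial ::
    "'n list \<Rightarrow> (real^'n \<Rightarrow> real) \<Rightarrow> real^'n \<Rightarrow> real \<Rightarrow> bool" where
  "has_iterated_partial [] = (\<lambda>\<Phi> b D. D = \<Phi> b)"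
| "has_iterated_partial (j # js) = (\<lambda>\<Phi> b D.
     \<exists>\<Psi>. (\<forall>\<^sub>F b' in nhds b. has_iterated_partial js \<Phi> b' (\<Psi> b')) \<and>
         ((\<lambda>t. \<Psi> (b + t *\<^sub>R axis j 1)) has_real_derivative D) (at 0))"

text \<open>
  The derivative \<open>\<Prod>\<^sub>j\<^sub>\<in>\<^sub>J \<partial>/\<partial>b\<^sub>j\<close> is indexed by a set, hence understood as existing with the same value
  for every order of differentiation.
\<close>

definition has_mixed_partial ::
    "'n set \<Rightarrow> (real^'n \<Rightarrow> real) \<Rightarrow> real^'n \<Rightarrow> real \<Rightarrow> bool" where
  "has_mixed_partial J \<Phi> b D \<longleftrightarrow>
     (\<forall>js. distinct js \<and> set js = J \<longrightarrow> has_iterated_partial js \<Phi> b D)"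

definition alpha :: "real^'n^'d \<Rightarrow> 'n \<Rightarrow> 'n \<Rightarrow> real" where
  "alpha a i j = (\<Sum>k\<in>UNIV. a $ k $ i * a $ k $ j)"

text \<open>
  Determinant of a square matrix with rows and columns indexed by the finite set \<open>J\<close>: the formula
  defining \<^const>\<open>det\<close>, with \<open>UNIV\<close> replaced by \<open>J\<close>.
\<close>

definition det_on :: "'n set \<Rightarrow> ('n \<Rightarrow> 'n \<Rightarrow> real) \<Rightarrow> real" where
  "det_on J M = (\<Sum>p | p permutes J. of_int (sign p) * (\<Prod>i\<in>J. M i (p i)))"

end

theory Submission
  imports Defs "HOL-Probability.Distributions"
begin

text \<open>
  For a generic linear functional \<open>l\<close> each nonempty face of the simple polytope \<open>P\<close> has exactly one
  minimal vertex, so \<open>\<F>\<close> splits into Boolean intervals indexed by the vertices. Restricted to the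
  faces contained in \<open>{j. f\<^sub>j(b, x) < 0}\<close>, each interval has alternating sum \<open>0\<close> as soon as \<open>l\<close> is close
  to \<open>- x / |x|\<close> and \<open>|x| > C |b|\<close>. Hence the integrand of \<open>\<phi>(a, b)\<close> vanishes for \<open>|x| > C |b|\<close>,
  which gives \<open>|\<phi>(a, b)| \<le> M |b|\<^sup>d\<close>.

  On the other hand every summand of \<open>\<phi>\<close> is a convolution of a bounded function with a Gaussian,
  evaluated at a point depending linearly on \<open>b\<close>; so all partial derivatives exist and are continuous,
  and they are limits of mixed difference quotients. Of order \<open>|J| < d\<close> these quotients are
  \<open>O(h\<^bsup>d - |J|\<^esup>)\<close> at \<open>b = 0\<close>. For \<open>|J| = d\<close> only the summand \<open>F = J\<close> survives, and the limit is the
  value of the Gaussian density at \<open>0\<close> times the volume of the parallelepiped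
  \<open>{x. -1 \<le> a\<^sub>j \<bullet> x < 0 for j \<in> J}\<close>.
\<close>

section \<open>Dual families and generic functionals\<close>

text \<open>Independence of a family rather than of a set, as in \<open>independent_forms\<close>: a
  repeated vector makes it dependent.\<close>

definition indep_family :: "'i set \<Rightarrow> ('i \<Rightarrow> 'v::real_vector) \<Rightarrow> bool" where
  "indep_family I a \<longleftrightarrow> (\<forall>c. (\<Sum>i\<in>I. c i *\<^sub>R a i) = 0 \<longrightarrow> (\<forall>i\<in>I. c i = 0))"

lemma indep_familyD:
  "indep_family I a \<Longrightarrow> (\<Sum>i\<in>I. c i *\<^sub>R a i) = 0 \<Longrightarrow> i \<in> I \<Longrightarrow> c i = 0"
  by (simp add: indep_family_def)

lemma span_image_finite:
  fixes a :: "'i \<Rightarrow> 'v::real_vector"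
  assumes "finite I" "x \<in> span (a ` I)"
  obtains c where "x = (\<Sum>i\<in>I. c i *\<^sub>R a i)"
proof -
  let ?S = "{x. \<exists>c. x = (\<Sum>i\<in>I. c i *\<^sub>R a i)}"
  have "subspace ?S"
    unfolding subspace_def
  proof (intro conjI allI ballI)
    show "0 \<in> ?S"
      by (auto intro: exI[of _ "\<lambda>_. 0"])
  next
    fix x y assume "x \<in> ?S" "y \<in> ?S"
    then obtain c d where "x = (\<Sum>i\<in>I. c i *\<^sub>R a i)" "y = (\<Sum>i\<in>I. d i *\<^sub>R a i)"
      by auto
    then have "x + y = (\<Sum>i\<in>I. (c i + d i) *\<^sub>R a i)"
      by (simp add: sum.distrib scaleR_left_distrib)
    then show "x + y \<in> ?S"
      by auto
  next
    fix r x assume "x \<in> ?S"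
    then obtain c where "x = (\<Sum>i\<in>I. c i *\<^sub>R a i)"
      by auto
    then have "r *\<^sub>R x = (\<Sum>i\<in>I. (r * c i) *\<^sub>R a i)"
      by (simp add: scaleR_sum_right)
    then show "r *\<^sub>R x \<in> ?S"
      by auto
  qed
  moreover have "a ` I \<subseteq> ?S"
  proof
    fix y assume "y \<in> a ` I"
    then obtain j where j: "j \<in> I" "y = a j"
      by auto
    have "(\<Sum>i\<in>I. (if i = j then 1 else 0) *\<^sub>R a i) = (\<Sum>i\<in>I. if i = j then a i else 0)"
      by (intro sum.cong) auto
    also have "\<dots> = a j"
      using j assms(1) by simp
    finally show "y \<in> ?S"
      using j by (auto intro!: exI[of _ "\<lambda>i. if i = j then 1 else 0"])
  qed
  ultimately have "span (a ` I) \<subseteq> ?S"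
    by (rule span_minimal[rotated])
  then show thesis
    using assms that by auto
qed

text \<open>The vector \<open>u j\<close> is a multiple of the component \<open>z\<close> of
  \<open>a j\<close> orthogonal to the span of the other vectors. Independence makes
  \<open>z\<close> nonzero, and \<open>a j\<close> pairs with \<open>z\<close> to
  \<open>z \<bullet> z\<close>, which fixes the scaling.\<close>

lemma exists_dual_family:
  fixes a :: "'i \<Rightarrow> 'v::euclidean_space"
  assumes fin: "finite I" and ind: "indep_family I a"
  shows "\<exists>u. \<forall>i\<in>I. \<forall>j\<in>I. a i \<bullet> u j = (if i = j then 1 else 0)"
proof -
  have "\<exists>u. \<forall>i\<in>I. a i \<bullet> u = (if i = j then 1 else 0)" if j: "j \<in> I" for j
  proof -
    have notin: "a j \<notin> span (a ` (I - {j}))"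
    proof
      assume "a j \<in> span (a ` (I - {j}))"
      then obtain c where c: "a j = (\<Sum>i\<in>I - {j}. c i *\<^sub>R a i)"
        using fin by (auto elim: span_image_finite[rotated])
      \<comment> \<open>The coefficient -1 at \<open>j\<close> turns the expansion of
        \<open>a j\<close> into a nontrivial vanishing combination.\<close>
      let ?c = "\<lambda>i. if i = j then -1 else c i"
      have "(\<Sum>i\<in>I. ?c i *\<^sub>R a i) = ?c j *\<^sub>R a j + (\<Sum>i\<in>I - {j}. ?c i *\<^sub>R a i)"
        using fin j by (rule sum.remove)
      also have "(\<Sum>i\<in>I - {j}. ?c i *\<^sub>R a i) = a j"
        unfolding c by (intro sum.cong) auto
      finally have "?c j = 0"
        using j by (intro indep_familyD[OF ind, of ?c]) simp_all
      then show False
        by simp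
    qed
    obtain y z where y: "y \<in> span (a ` (I - {j}))"
      and z: "\<And>w. w \<in> span (a ` (I - {j})) \<Longrightarrow> orthogonal z w" and yz: "a j = y + z"
      using orthogonal_subspace_decomp_exists by metis
    have "z \<noteq> 0"
      using notin y yz by auto
    have zi: "a i \<bullet> z = 0" if "i \<in> I" "i \<noteq> j" for i
      using z[of "a i"] that by (auto simp: orthogonal_def inner_commute intro: span_base)
    have zj: "a j \<bullet> z = z \<bullet> z"
      using z[OF y] yz by (simp add: orthogonal_def inner_add_left inner_add_right inner_commute)
    show ?thesis
      using \<open>z \<noteq> 0\<close> zi zj by (intro exI[of _ "(1 / (z \<bullet> z)) *\<^sub>R z"]) auto
  qed
  then show ?thesis
    by metis
qed

text \<open>Pairing with \<open>u j\<close> isolates the coefficient of \<open>a j\<close> in any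
  expansion of \<open>l\<close>.\<close>

lemma span_dual_expansion:
  fixes a :: "'i \<Rightarrow> 'v::euclidean_space"
  assumes fin: "finite I" and dual: "\<And>i j. i \<in> I \<Longrightarrow> j \<in> I \<Longrightarrow> a i \<bullet> u j = (if i = j then 1 else 0)"
    and l: "l \<in> span (a ` I)"
  shows "l = (\<Sum>i\<in>I. (l \<bullet> u i) *\<^sub>R a i)"
proof -
  obtain c where c: "l = (\<Sum>i\<in>I. c i *\<^sub>R a i)"
    using span_image_finite[OF fin l] .
  have "l \<bullet> u j = c j" if j: "j \<in> I" for j
  proof -
    have "l \<bullet> u j = (\<Sum>i\<in>I. c i * (a i \<bullet> u j))"
      unfolding c by (simp add: inner_sum_left)
    also have "\<dots> = (\<Sum>i\<in>I. if i = j then c i else 0)"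
      using dual j by (intro sum.cong) auto
    finally show ?thesis
      using fin j by simp
  qed
  then show ?thesis
    using c by simp
qed

lemma span_image_eq_UNIV_separates:
  fixes a :: "'i \<Rightarrow> 'v::euclidean_space"
  assumes "span (a ` I) = UNIV" "\<And>i. i \<in> I \<Longrightarrow> a i \<bullet> x = 0"
  shows "x = 0"
proof -
  have "orthogonal x y" if "y \<in> span (a ` I)" for y
    using that assms(2)
    by (intro orthogonal_to_span[of y "a ` I" x]) (auto simp: orthogonal_def inner_commute)
  then have "orthogonal x x"
    using assms(1) by auto
  then show ?thesis
    by (simp add: orthogonal_self)
qed

lemma not_span_image_UNIV_orthogonal:
  fixes a :: "'i \<Rightarrow> 'v::euclidean_space"
  assumes "l \<notin> span (a ` I)"
  obtains u where "\<And>i. i \<in> I \<Longrightarrow> a i \<bullet> u = 0" "l \<bullet> u > 0"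
proof -
  obtain y z where y: "y \<in> span (a ` I)"
    and z: "\<And>w. w \<in> span (a ` I) \<Longrightarrow> orthogonal z w" and yz: "l = y + z"
    using orthogonal_subspace_decomp_exists by metis
  have "z \<noteq> 0"
    using assms y yz by auto
  have "a i \<bullet> z = 0" if "i \<in> I" for i
    using z[of "a i"] that by (auto simp: orthogonal_def inner_commute intro: span_base)
  moreover have "l \<bullet> z > 0"
    using z[OF y] yz \<open>z \<noteq> 0\<close> by (simp add: orthogonal_def inner_add_right inner_commute)
  ultimately show thesis
    using that by blast
qed

text \<open>Genericity serves twice: a minimum of \<open>l\<close> on a face can only occur at a
  vertex, and the expansion of \<open>l\<close> at a vertex has no zero coefficient.\<close>

definition generic_for :: "('i \<Rightarrow> 'v::euclidean_space) \<Rightarrow> 'v \<Rightarrow> bool" where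
  "generic_for a l \<longleftrightarrow> (\<forall>I. span (a ` I) \<noteq> UNIV \<longrightarrow> l \<notin> span (a ` I))"

text \<open>The forbidden set is a finite union of proper subspaces, hence negligible, and so cannot
  cover a ball.\<close>

lemma exists_generic_near:
  fixes a :: "'i::finite \<Rightarrow> 'v::euclidean_space"
  assumes "e > 0"
  obtains l where "generic_for a l" "norm (l - z) < e"
proof -
  let ?N = "\<Union>I\<in>{I. span (a ` I) \<noteq> UNIV}. span (a ` I)"
  have "negligible ?N"
  proof (rule negligible_Union)
    fix T assume "T \<in> (\<lambda>I. span (a ` I)) ` {I. span (a ` I) \<noteq> UNIV}"
    then obtain I where T: "T = span (a ` I)" and "span (a ` I) \<noteq> UNIV"
      by auto
    then have "dim (span (a ` I)) \<noteq> DIM('v)"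
      using dim_eq_full[of "span (a ` I)"] by (simp only: span_span) simp
    then have "dim (span (a ` I)) < DIM('v)"
      using dim_subset_UNIV[of "span (a ` I)"] by linarith
    then show "negligible T"
      unfolding T by (rule negligible_lowdim)
  qed simp
  moreover have "\<not> negligible (ball z e)"
    using assms by (intro open_not_negligible) auto
  ultimately have "\<not> ball z e \<subseteq> ?N"
    using negligible_subset by blast
  then obtain l where "l \<in> ball z e" "l \<notin> ?N"
    by blast
  then show thesis
    using that[of l] by (auto simp: generic_for_def dist_norm norm_minus_commute)
qed

section \<open>Alternating sums over faces of a simple polytope\<close>

definition poly_set :: "('n \<Rightarrow> 'v::euclidean_space) \<Rightarrow> ('n \<Rightarrow> real) \<Rightarrow> 'v set" where
  "poly_set a \<beta> = {y. \<forall>j. 0 \<le> a j \<bullet> y + \<beta> j}"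

definition active :: "('n \<Rightarrow> 'v::euclidean_space) \<Rightarrow> ('n \<Rightarrow> real) \<Rightarrow> 'v \<Rightarrow> 'n set" where
  "active a \<beta> y = {j. a j \<bullet> y + \<beta> j = 0}"

definition face_complex :: "('n \<Rightarrow> 'v::euclidean_space) \<Rightarrow> ('n \<Rightarrow> real) \<Rightarrow> 'n set set" where
  "face_complex a \<beta> = {F. \<exists>y\<in>poly_set a \<beta>. F \<subseteq> active a \<beta> y}"

text \<open>For small positive \<open>s\<close> the active constraints survive by the sign of
  \<open>a j \<bullet> u\<close>, the inactive ones by continuity; finitely many such conditions
  hold simultaneously.\<close>

lemma poly_set_moveable:
  fixes a :: "'n::finite \<Rightarrow> 'v::euclidean_space"
  assumes y: "y \<in> poly_set a \<beta>" and u: "\<And>j. j \<in> active a \<beta> y \<Longrightarrow> 0 \<le> a j \<bullet> u"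
  obtains s where "s > 0" "y + s *\<^sub>R u \<in> poly_set a \<beta>"
proof -
  have "\<forall>\<^sub>F s in at_right 0. 0 \<le> a j \<bullet> (y + s *\<^sub>R u) + \<beta> j" for j
  proof (cases "j \<in> active a \<beta> y")
    case True
    then have eq: "a j \<bullet> (y + s *\<^sub>R u) + \<beta> j = s * (a j \<bullet> u)" for s
      by (simp add: active_def inner_add_right)
    show ?thesis
      unfolding eq using u[OF True] eventually_at_right_less[of "0::real"]
      by (auto elim!: eventually_mono)
  next
    case False
    then have pos: "0 < a j \<bullet> (y + 0 *\<^sub>R u) + \<beta> j"
      using y unfolding poly_set_def active_def by (auto simp: less_le)
    have "((\<lambda>s. a j \<bullet> (y + s *\<^sub>R u) + \<beta> j) \<longlongrightarrow> a j \<bullet> (y + 0 *\<^sub>R u) + \<beta> j) (at_right 0)"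
      by (intro tendsto_intros)
    then have "\<forall>\<^sub>F s in at_right 0. 0 < a j \<bullet> (y + s *\<^sub>R u) + \<beta> j"
      using pos by (rule order_tendstoD)
    then show ?thesis
      by (auto elim: eventually_mono)
  qed
  then have "\<forall>\<^sub>F s in at_right 0. \<forall>j. 0 \<le> a j \<bullet> (y + s *\<^sub>R u) + \<beta> j"
    by (simp add: eventually_all_finite)
  then have "\<forall>\<^sub>F s in at_right (0::real). s > 0 \<and> (\<forall>j. 0 \<le> a j \<bullet> (y + s *\<^sub>R u) + \<beta> j)"
    using eventually_at_right_less by (rule eventually_conj[rotated])
  then have "\<exists>s>0. \<forall>j. 0 \<le> a j \<bullet> (y + s *\<^sub>R u) + \<beta> j"
    by (rule eventually_happens'[rotated]) simp
  then show thesis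
    using that by (auto simp: poly_set_def)
qed

lemma closed_poly_set_face: "closed {y\<in>poly_set a \<beta>. F \<subseteq> active a \<beta> y}"
proof -
  have "{y\<in>poly_set a \<beta>. F \<subseteq> active a \<beta> y} =
      (\<Inter>j. {y. - \<beta> j \<le> a j \<bullet> y}) \<inter> (\<Inter>j\<in>F. {y. a j \<bullet> y = - \<beta> j})"
    by (auto simp: poly_set_def active_def; smt (verit) subset_iff mem_Collect_eq)
  then show ?thesis
    by (simp add: closed_INT closed_Int closed_halfspace_ge closed_hyperplane)
qed

text \<open>A proper inclusion leaves as many even as odd sets between \<open>A\<close> and
  \<open>B\<close>; without an inclusion the range of summation is empty.\<close>

lemma sum_alternating_interval:
  assumes "finite B" "A \<noteq> B"
  shows "(\<Sum>F | A \<subseteq> F \<and> F \<subseteq> B. (-1) ^ card F) = (0::real)"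
proof (cases "A \<subseteq> B")
  case True
  have fin: "finite {F. A \<subseteq> F \<and> F \<subseteq> B}"
    using assms(1) by (auto intro: finite_subset[of _ "Pow B"])
  show ?thesis
    using card_subsupersets_even_odd[of B A] assms True
    by (intro sum_alternating_cancels fin) (auto simp: conj_ac)
next
  case False
  then have "{F. A \<subseteq> F \<and> F \<subseteq> B} = {}"
    by auto
  then show ?thesis
    by (simp only: sum.empty)
qed

text \<open>
  The vectors \<open>u I j\<close> form a dual family of \<open>a j\<close>, \<open>j \<in> I\<close>, for every set \<open>I\<close> of constraints active at
  a point of the polytope; their existence says that these \<open>a j\<close> are linearly independent.
\<close>

locale simple_polytope =
  fixes a :: "'n::finite \<Rightarrow> 'v::euclidean_space" and \<beta> :: "'n \<Rightarrow> real" and u :: "'n set \<Rightarrow> 'n \<Rightarrow> 'v"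
  assumes bounded_poly: "bounded (poly_set a \<beta>)"
    and dual: "\<And>y i j. y \<in> poly_set a \<beta> \<Longrightarrow> i \<in> active a \<beta> y \<Longrightarrow> j \<in> active a \<beta> y \<Longrightarrow>
      a i \<bullet> u (active a \<beta> y) j = (if i = j then 1 else 0)"
begin

abbreviation "P \<equiv> poly_set a \<beta>"
abbreviation "act \<equiv> active a \<beta>"

definition vertices :: "'v set" where
  "vertices = {v\<in>P. span (a ` act v) = UNIV}"

text \<open>
  The vertex \<open>v\<close> minimizes \<open>l\<close> on the face with index set \<open>F \<subseteq> act v\<close> iff \<open>descents l v \<subseteq> F\<close>: moving along
  the edge direction \<open>u (act v) j\<close> leaves exactly the constraint \<open>j\<close>.
\<close>

definition descents :: "'v \<Rightarrow> 'v \<Rightarrow> 'n set" where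
  "descents l v = {j\<in>act v. l \<bullet> u (act v) j < 0}"

section \<open>Vertices and the expansion of linear functionals at a vertex\<close>

lemma vertices_in: "v \<in> vertices \<Longrightarrow> v \<in> P"
  by (simp add: vertices_def)

lemma vertices_eqI:
  assumes "v \<in> vertices" "act v \<subseteq> act w"
  shows "v = w"
proof -
  have "v - w = 0"
  proof (rule span_image_eq_UNIV_separates[of a "act v"])
    fix i assume "i \<in> act v"
    then have "a i \<bullet> v + \<beta> i = 0" "a i \<bullet> w + \<beta> i = 0"
      using assms by (auto simp: active_def)
    then show "a i \<bullet> (v - w) = 0"
      by (simp add: inner_diff_right)
  qed (use assms in \<open>simp add: vertices_def\<close>)
  then show ?thesis
    by simp
qed

lemma finite_vertices: "finite vertices"
proof (rule finite_imageD)
  show "inj_on act vertices"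
    by (rule inj_onI) (auto intro: vertices_eqI)
qed simp

lemma vertex_expansion:
  assumes "v \<in> vertices"
  shows "l \<bullet> x = (\<Sum>j\<in>act v. (l \<bullet> u (act v) j) * (a j \<bullet> x))"
proof -
  have "l = (\<Sum>j\<in>act v. (l \<bullet> u (act v) j) *\<^sub>R a j)"
    using assms by (intro span_dual_expansion dual) (auto simp: vertices_def)
  then have "l \<bullet> x = (\<Sum>j\<in>act v. (l \<bullet> u (act v) j) *\<^sub>R a j) \<bullet> x"
    by (rule arg_cong)
  then show ?thesis
    by (simp add: inner_sum_left)
qed

text \<open>If the coefficient vanished, \<open>l\<close> would lie in the span of the remaining
  active normals. That span is proper, since the nonzero vector \<open>u (act v) j\<close> is
  orthogonal to it, and a generic \<open>l\<close> avoids it.\<close>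

lemma generic_coefficient_nonzero:
  assumes l: "generic_for a l" and v: "v \<in> vertices" and j: "j \<in> act v"
  shows "l \<bullet> u (act v) j \<noteq> 0"
proof
  assume 0: "l \<bullet> u (act v) j = 0"
  let ?I = "act v - {j}"
  have perp: "a i \<bullet> u (act v) j = 0" if "i \<in> ?I" for i
    using dual[OF vertices_in[OF v]] that j by auto
  have "u (act v) j \<noteq> 0"
    using dual[OF vertices_in[OF v] j j] by auto
  then have "span (a ` ?I) \<noteq> UNIV"
    using perp span_image_eq_UNIV_separates[of a ?I] by blast
  then have "l \<notin> span (a ` ?I)"
    using l by (simp add: generic_for_def)
  moreover have "(\<Sum>i\<in>?I. (l \<bullet> u (act v) i) *\<^sub>R a i) \<in> span (a ` ?I)"
    by (intro span_sum span_scale span_base imageI)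
  moreover have "(\<Sum>i\<in>act v. (l \<bullet> u (act v) i) *\<^sub>R a i) = (\<Sum>i\<in>?I. (l \<bullet> u (act v) i) *\<^sub>R a i)"
    using 0 j by (simp add: sum.remove[of "act v" j])
  moreover have "l = (\<Sum>i\<in>act v. (l \<bullet> u (act v) i) *\<^sub>R a i)"
    using v by (intro span_dual_expansion dual) (auto simp: vertices_def)
  ultimately show False
    by metis
qed

text \<open>The vertex is a minimizer of \<open>l\<close> on the compact face cut out by
  \<open>F\<close>. At a non-vertex, genericity yields a direction along all active constraints that
  lowers \<open>l\<close>; at a vertex, a descent outside \<open>F\<close> would yield one that
  stays in the face.\<close>

lemma exists_minimal_vertex:
  assumes l: "generic_for a l" and F: "F \<in> face_complex a \<beta>"
  obtains v where "v \<in> vertices" "descents l v \<subseteq> F" "F \<subseteq> act v"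
proof -
  let ?G = "{y\<in>P. F \<subseteq> act y}"
  have "bounded ?G"
    by (rule bounded_subset[OF bounded_poly]) auto
  then have "compact ?G"
    by (simp add: compact_eq_bounded_closed closed_poly_set_face)
  moreover have "?G \<noteq> {}"
    using F by (auto simp: face_complex_def)
  moreover have "continuous_on ?G (\<lambda>y. l \<bullet> y)"
    by (intro continuous_intros)
  ultimately obtain v where v: "v \<in> ?G" and min: "\<And>y. y \<in> ?G \<Longrightarrow> l \<bullet> v \<le> l \<bullet> y"
    using continuous_attains_inf[of ?G "\<lambda>y. l \<bullet> y"] by blast
  \<comment> \<open>No direction that keeps the constraints in \<open>F\<close> active and is
    feasible for the others can lower \<open>l\<close>, by minimality of \<open>v\<close>.\<close>
  have improve: False
    if w0: "\<And>j. j \<in> act v \<Longrightarrow> 0 \<le> a j \<bullet> w" and wF: "\<And>j. j \<in> F \<Longrightarrow> a j \<bullet> w = 0"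
      and neg: "l \<bullet> w < 0" for w
  proof -
    obtain s where s: "s > 0" "v + s *\<^sub>R w \<in> P"
      using poly_set_moveable[of v a \<beta> w] v w0 by blast
    have "v + s *\<^sub>R w \<in> ?G"
      using v s wF by (auto simp: active_def inner_add_right)
    then have "0 \<le> s * (l \<bullet> w)"
      using min by (force simp: inner_add_right)
    then show False
      using s neg by (simp add: zero_le_mult_iff)
  qed
  have "span (a ` act v) = UNIV"
  proof (rule ccontr)
    assume "span (a ` act v) \<noteq> UNIV"
    then have "l \<notin> span (a ` act v)"
      using l by (simp add: generic_for_def)
    then obtain w where w: "\<And>i. i \<in> act v \<Longrightarrow> a i \<bullet> w = 0" "l \<bullet> w > 0"
      by (rule not_span_image_UNIV_orthogonal) blast
    show False
      using w v by (intro improve[of "- w"]) auto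
  qed
  moreover have "descents l v \<subseteq> F"
  proof
    fix j assume j: "j \<in> descents l v"
    show "j \<in> F"
    proof (rule ccontr)
      assume "j \<notin> F"
      then show False
        using j v dual[of v] by (intro improve[of "u (act v) j"]) (auto simp: descents_def)
    qed
  qed
  ultimately show thesis
    using v that by (auto simp: vertices_def)
qed

text \<open>Expand \<open>l \<bullet> (w - v)\<close> at \<open>v\<close>: terms in \<open>F\<close>
  vanish, and outside \<open>F\<close> both factors are nonnegative. The same holds with the roles
  exchanged, so every term is zero. As the coefficients of a generic \<open>l\<close> are nonzero,
  all constraints active at \<open>v\<close> are active at \<open>w\<close>.\<close>

lemma minimal_vertex_unique:
  assumes l: "generic_for a l"
    and v: "v \<in> vertices" "descents l v \<subseteq> F" "F \<subseteq> act v"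
    and w: "w \<in> vertices" "descents l w \<subseteq> F" "F \<subseteq> act w"
  shows "v = w"
proof -
  have nonneg: "0 \<le> (l \<bullet> u (act p) j) * (a j \<bullet> (q - p))"
    if p: "p \<in> vertices" "descents l p \<subseteq> F" and q: "q \<in> vertices" "F \<subseteq> act q"
      and j: "j \<in> act p" for p q j
  proof (cases "j \<in> F")
    case True
    then have "a j \<bullet> (q - p) = 0"
      using j q(2) by (auto simp: active_def inner_diff_right)
    then show ?thesis
      by simp
  next
    case False
    then have "0 \<le> l \<bullet> u (act p) j"
      using p j by (auto simp: descents_def)
    moreover have "0 \<le> a j \<bullet> (q - p)"
      using j vertices_in[OF q(1)] unfolding active_def poly_set_def inner_diff_right
      by (smt (verit) mem_Collect_eq)
    ultimately show ?thesis
      by simp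
  qed
  have "0 \<le> l \<bullet> (v - w)"
    unfolding vertex_expansion[OF w(1), of l "v - w"] using nonneg[OF w(1,2) v(1,3)] by (rule sum_nonneg)
  then have "l \<bullet> (w - v) \<le> 0"
    by (simp add: inner_diff_right)
  moreover have "0 \<le> (\<Sum>j\<in>act v. (l \<bullet> u (act v) j) * (a j \<bullet> (w - v)))"
    using nonneg[OF v(1,2) w(1,3)] by (rule sum_nonneg)
  ultimately have "(\<Sum>j\<in>act v. (l \<bullet> u (act v) j) * (a j \<bullet> (w - v))) = 0"
    unfolding vertex_expansion[OF v(1), of l "w - v"] by linarith
  then have zero: "(l \<bullet> u (act v) j) * (a j \<bullet> (w - v)) = 0" if "j \<in> act v" for j
    using that nonneg[OF v(1,2) w(1,3)] by (subst (asm) sum_nonneg_eq_0_iff) auto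
  have "act v \<subseteq> act w"
  proof
    fix j assume j: "j \<in> act v"
    then have "a j \<bullet> (w - v) = 0"
      using zero generic_coefficient_nonzero[OF l v(1)] by auto
    then show "j \<in> act w"
      using j by (simp add: active_def inner_diff_right)
  qed
  then show ?thesis
    by (rule vertices_eqI[OF v(1)])
qed

text \<open>Existence and uniqueness of the minimal vertex make the intervals from
  \<open>descents l v\<close> to \<open>act v\<close> a partition of the complex; restriction to
  subsets of \<open>V\<close> only shrinks the upper ends.\<close>

lemma alternating_sum_via_vertices:
  assumes l: "generic_for a l"
  shows "(\<Sum>F | F \<in> face_complex a \<beta> \<and> F \<subseteq> V. (-1) ^ card F) =
    (\<Sum>v\<in>vertices. \<Sum>F | descents l v \<subseteq> F \<and> F \<subseteq> act v \<inter> V. (-1) ^ card F :: real)"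
proof -
  have "{F. F \<in> face_complex a \<beta> \<and> F \<subseteq> V} =
      (\<Union>v\<in>vertices. {F. descents l v \<subseteq> F \<and> F \<subseteq> act v \<inter> V})" (is "?L = ?R")
  proof
    show "?L \<subseteq> ?R"
    proof
      fix F assume F: "F \<in> ?L"
      then obtain v where "v \<in> vertices" "descents l v \<subseteq> F" "F \<subseteq> act v"
        using exists_minimal_vertex[OF l] by blast
      then show "F \<in> ?R"
        using F by blast
    qed
    show "?R \<subseteq> ?L"
      using vertices_in unfolding face_complex_def by blast
  qed
  moreover have "(\<Sum>F\<in>?R. (-1) ^ card F :: real) =
      (\<Sum>v\<in>vertices. \<Sum>F | descents l v \<subseteq> F \<and> F \<subseteq> act v \<inter> V. (-1) ^ card F)"
    using finite_vertices minimal_vertex_unique[OF l] by (intro sum.UNION_disjoint) auto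
  ultimately show ?thesis
    by simp
qed

text \<open>An interval can contribute only if \<open>descents l v\<close> equals the set of
  constraints active at \<open>v\<close> and negative at \<open>x\<close>. Then coefficients and
  affine forms agree in sign, so \<open>l \<bullet> x\<close> is bounded below by a multiple of
  \<open>- norm b\<close>. A functional close to \<open>- sgn x\<close> contradicts this for large
  \<open>x\<close>.\<close>

lemma alternating_sum_eq_0:
  obtains C where "C > 0" "\<And>x b. norm x > C * norm (b :: real^'n) \<Longrightarrow>
    (\<Sum>F | F \<in> face_complex a \<beta> \<and> F \<subseteq> {j. a j \<bullet> x + b $ j < 0}. (-1) ^ card F :: real) = 0"
proof -
  define M where "M = (\<Sum>v\<in>vertices. \<Sum>j\<in>act v. norm (u (act v) j))"
  have M: "(\<Sum>j\<in>act v. norm (u (act v) j)) \<le> M" if "v \<in> vertices" for v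
    unfolding M_def using that finite_vertices by (intro member_le_sum) (auto intro: sum_nonneg)
  have M0: "M \<ge> 0"
    unfolding M_def by (intro sum_nonneg) auto
  show thesis
  \<comment> \<open>The estimate below gives \<open>norm x \<le> 3 * M * norm b\<close>; adding 1
    keeps the constant positive even when \<open>M\<close> is 0.\<close>
  proof (rule that[of "3 * M + 1"])
    fix x :: 'v and b :: "real^'n"
    assume big: "norm x > (3 * M + 1) * norm b"
    let ?V = "{j. a j \<bullet> x + b $ j < 0}"
    have "0 \<le> (3 * M + 1) * norm b"
      using M0 by simp
    then have x0: "norm x > 0"
      using big by linarith
    \<comment> \<open>The functional may depend on \<open>x\<close>, because \<open>M\<close> does
      not involve \<open>l\<close>. The radius 1/2 gives both \<open>norm l \<le> 3/2\<close> and
      \<open>l \<bullet> x \<le> - norm x / 2\<close>.\<close>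
    obtain l where l: "generic_for a l" and near: "norm (l - - sgn x) < 1/2"
      using exists_generic_near[of "1/2" a "- sgn x"] by auto
    have "norm l \<le> norm (l - - sgn x) + norm (sgn x)"
      using norm_triangle_ineq[of "l - - sgn x" "- sgn x"] by simp
    then have nl: "norm l \<le> 3/2"
      using near by (simp add: norm_sgn split: if_splits)
    have "l \<bullet> x = (l - - sgn x) \<bullet> x - sgn x \<bullet> x"
      by (simp add: inner_add_left)
    also have "sgn x \<bullet> x = norm x"
      using x0 by (simp add: sgn_div_norm dot_square_norm power2_eq_square)
    also have "(l - - sgn x) \<bullet> x \<le> norm (l - - sgn x) * norm x"
      by (rule norm_cauchy_schwarz)
    also have "norm (l - - sgn x) * norm x \<le> 1/2 * norm x"
      using near by (intro mult_right_mono) auto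
    finally have lx: "l \<bullet> x \<le> - norm x / 2"
      by simp
    have ne: "descents l v \<noteq> act v \<inter> ?V" if v: "v \<in> vertices" for v
    proof
      assume eq: "descents l v = act v \<inter> ?V"
      have "- (3/2 * norm b * norm (u (act v) j)) \<le> (l \<bullet> u (act v) j) * (a j \<bullet> x)" if j: "j \<in> act v" for j
      proof -
        \<comment> \<open>By \<open>eq\<close>, an active constraint has a negative coefficient
          exactly when its affine form is negative at \<open>x\<close>.\<close>
        have "0 \<le> (l \<bullet> u (act v) j) * (a j \<bullet> x + b $ j)"
        proof (cases "j \<in> ?V")
          case True
          then have "l \<bullet> u (act v) j < 0"
            using eq j by (auto simp: descents_def)
          then show ?thesis
            using True by (simp add: mult_nonpos_nonpos)
        next
          case False
          then have "\<not> l \<bullet> u (act v) j < 0"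
            using eq j unfolding descents_def by blast
          then show ?thesis
            using False by simp
        qed
        moreover have "(l \<bullet> u (act v) j) * b $ j \<le> \<bar>l \<bullet> u (act v) j\<bar> * \<bar>b $ j\<bar>"
          by (metis abs_ge_self abs_mult)
        moreover have "\<bar>l \<bullet> u (act v) j\<bar> * \<bar>b $ j\<bar> \<le> (norm l * norm (u (act v) j)) * norm b"
          by (intro mult_mono Cauchy_Schwarz_ineq2 component_le_norm_cart) auto
        moreover have "norm l * (norm (u (act v) j) * norm b) \<le> 3/2 * (norm (u (act v) j) * norm b)"
          using nl by (intro mult_right_mono) auto
        ultimately show ?thesis
          by (simp add: algebra_simps)
      qed
      then have "(\<Sum>j\<in>act v. - (3/2 * norm b * norm (u (act v) j))) \<le> l \<bullet> x"
        unfolding vertex_expansion[OF v, of l x] by (rule sum_mono)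
      then have "- (3/2 * norm b * (\<Sum>j\<in>act v. norm (u (act v) j))) \<le> l \<bullet> x"
        by (simp add: sum_negf sum_distrib_left)
      moreover have "3/2 * norm b * (\<Sum>j\<in>act v. norm (u (act v) j)) \<le> 3/2 * norm b * M"
        using M[OF v] by (intro mult_left_mono) auto
      ultimately have "norm x \<le> 3 * M * norm b"
        using lx by (simp add: algebra_simps)
      then show False
        using big norm_ge_zero[of b] by (simp add: algebra_simps)
    qed
    show "(\<Sum>F | F \<in> face_complex a \<beta> \<and> F \<subseteq> ?V. (-1) ^ card F :: real) = 0"
      unfolding alternating_sum_via_vertices[OF l]
      using ne by (intro sum.neutral ballI sum_alternating_interval) auto
  qed (use M0 in simp)
qed

end

section \<open>Convolution with Gaussians\<close>

text \<open>This class contains the Gaussian and is closed under directional derivatives, so one set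
  of estimates covers derivatives of every order.\<close>

definition gauss_poly :: "('v::euclidean_space \<Rightarrow> real) \<Rightarrow> bool" where
  "gauss_poly g \<longleftrightarrow> (\<exists>p. real_polynomial_function p \<and> g = (\<lambda>x. p x * exp (- (x \<bullet> x) / 2)))"

lemma real_polynomial_function_has_directional_derivative:
  fixes u :: "'v::euclidean_space"
  assumes "real_polynomial_function p"
  shows "\<exists>p'. real_polynomial_function p' \<and>
    (\<forall>x t. ((\<lambda>t. p (x + t *\<^sub>R u)) has_real_derivative p' (x + t *\<^sub>R u)) (at t))"
  using assms
proof induction
  case (linear f)
  interpret bounded_linear f by fact
  show ?case
    by (intro exI[of _ "\<lambda>_. f u"])
      (auto simp: add scaleR intro!: derivative_eq_intros)
next
  case (const c)
  show ?case
    by (intro exI[of _ "\<lambda>_. 0"]) (auto intro:)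
next
  case (add f g)
  then obtain f' g' where "real_polynomial_function f'" "real_polynomial_function g'"
    "\<And>x t. ((\<lambda>t. f (x + t *\<^sub>R u)) has_real_derivative f' (x + t *\<^sub>R u)) (at t)"
    "\<And>x t. ((\<lambda>t. g (x + t *\<^sub>R u)) has_real_derivative g' (x + t *\<^sub>R u)) (at t)"
    by blast
  then show ?case
    by (intro exI[of _ "\<lambda>x. f' x + g' x"])
      (auto intro: DERIV_add)
next
  case (mult f g)
  then obtain f' g' where "real_polynomial_function f'" "real_polynomial_function g'"
    "\<And>x t. ((\<lambda>t. f (x + t *\<^sub>R u)) has_real_derivative f' (x + t *\<^sub>R u)) (at t)"
    "\<And>x t. ((\<lambda>t. g (x + t *\<^sub>R u)) has_real_derivative g' (x + t *\<^sub>R u)) (at t)"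
    by blast
  with mult.hyps show ?case
    by (intro exI[of _ "\<lambda>x. f' x * g x + g' x * f x"])
      (auto intro: DERIV_mult)
qed

lemma gauss_poly_has_directional_derivative:
  fixes u :: "'v::euclidean_space"
  assumes "gauss_poly g"
  obtains g' where "gauss_poly g'"
    "\<And>x t. ((\<lambda>t. g (x + t *\<^sub>R u)) has_real_derivative g' (x + t *\<^sub>R u)) (at t)"
proof -
  obtain p where p: "real_polynomial_function p" and g: "g = (\<lambda>x. p x * exp (- (x \<bullet> x) / 2))"
    using assms by (auto simp: gauss_poly_def)
  obtain p' where p': "real_polynomial_function p'"
    and dp: "\<And>x t. ((\<lambda>t. p (x + t *\<^sub>R u)) has_real_derivative p' (x + t *\<^sub>R u)) (at t)"
    using real_polynomial_function_has_directional_derivative[OF p, of u] by blast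
  show thesis
  proof (rule that)
    have "real_polynomial_function (\<lambda>x. p' x + (-1) * (x \<bullet> u) * p x)"
      using p p' bounded_linear_inner_left[of u] by (intro real_polynomial_function.intros(2-4)) auto
    then show "gauss_poly (\<lambda>x. (p' x + (-1) * (x \<bullet> u) * p x) * exp (- (x \<bullet> x) / 2))"
      unfolding gauss_poly_def by (intro exI conjI) auto
    show "((\<lambda>t. g (x + t *\<^sub>R u)) has_real_derivative
        (\<lambda>x. (p' x + (-1) * (x \<bullet> u) * p x) * exp (- (x \<bullet> x) / 2)) (x + t *\<^sub>R u)) (at t)" for x t
    proof -
      have "((\<lambda>t. - ((x + t *\<^sub>R u) \<bullet> (x + t *\<^sub>R u)) / 2) has_real_derivative - ((x + t *\<^sub>R u) \<bullet> u)) (at t)"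
      proof -
        have "(\<lambda>t. - ((x + t *\<^sub>R u) \<bullet> (x + t *\<^sub>R u)) / 2) =
            (\<lambda>t. - (x \<bullet> x + 2 * t * (x \<bullet> u) + t * t * (u \<bullet> u)) / 2)"
          by (intro ext) (simp add: inner_add_left inner_add_right inner_commute[of u x] field_simps)
        then show ?thesis
          by (auto intro!: derivative_eq_intros simp: inner_add_left)
      qed
      from DERIV_mult[OF dp[of x t] DERIV_fun_exp[OF this]] show ?thesis
        unfolding g by (rule DERIV_cong) algebra
    qed
  qed
qed

text \<open>The rate \<open>e\<close> is arbitrary in the induction because a product distributes it
  as \<open>e / 2\<close> to each factor.\<close>

lemma real_polynomial_function_le_exp:
  fixes p :: "'v::euclidean_space \<Rightarrow> real"
  assumes "real_polynomial_function p" "e > 0"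
  shows "\<exists>M\<ge>0. \<forall>x. \<bar>p x\<bar> \<le> M * exp (e * (x \<bullet> x))"
  using assms
proof (induction arbitrary: e)
  case (linear f)
  interpret bounded_linear f by fact
  obtain K where K: "K \<ge> 0" "\<And>x. norm (f x) \<le> norm x * K"
    using nonneg_bounded by blast
  have "\<bar>f x\<bar> \<le> K * (1 + 1 / e) * exp (e * (x \<bullet> x))" for x
  proof -
    let ?E = "exp (e * (x \<bullet> x))"
    have E: "e * (x \<bullet> x) \<le> ?E"
      using exp_ge_add_one_self[of "e * (x \<bullet> x)"] by linarith
    \<comment> \<open>This follows from nonnegativity of
      \<open>(norm x - 1)\<^sup>2 + (norm x)\<^sup>2\<close>.\<close>
    have "norm x \<le> 1 + x \<bullet> x"
      using sum_power2_ge_zero[of "norm x - 1" "norm x"] 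
      by (simp add: power2_norm_eq_inner[symmetric] power2_eq_square algebra_simps)
    moreover have "x \<bullet> x \<le> 1 / e * ?E"
      using E linear.prems by (simp add: field_simps)
    moreover have "1 \<le> ?E"
      using linear.prems by simp
    ultimately have "norm x \<le> (1 + 1 / e) * ?E"
      unfolding distrib_right mult_1_left by linarith
    then have "norm x * K \<le> (1 + 1 / e) * ?E * K"
      using K(1) by (rule mult_right_mono)
    then show ?thesis
      using K(2)[of x] by (simp add: mult_ac)
  qed
  then show ?case
    using K linear.prems by (intro exI[of _ "K * (1 + 1 / e)"]) auto
next
  case (const c)
  have "\<bar>c\<bar> * 1 \<le> \<bar>c\<bar> * exp (e * (x \<bullet> x))" for x :: 'v
    using const by (intro mult_left_mono) auto
  then show ?case
    by (intro exI[of _ "\<bar>c\<bar>"]) auto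
next
  case (add f g)
  from add.IH(1)[OF add.prems] add.IH(2)[OF add.prems] obtain M N
    where M: "M \<ge> 0" "\<And>x. \<bar>f x\<bar> \<le> M * exp (e * (x \<bullet> x))"
      and N: "N \<ge> 0" "\<And>x. \<bar>g x\<bar> \<le> N * exp (e * (x \<bullet> x))"
    by blast
  have "\<bar>f x + g x\<bar> \<le> (M + N) * exp (e * (x \<bullet> x))" for x
    using M(2)[of x] N(2)[of x] by (simp add: algebra_simps)
  then show ?case
    using M(1) N(1) by (intro exI[of _ "M + N"]) auto
next
  case (mult f g)
  have e2: "e / 2 > 0"
    using mult.prems by simp
  from mult.IH(1)[OF e2] mult.IH(2)[OF e2] obtain M N
    where M: "M \<ge> 0" "\<And>x. \<bar>f x\<bar> \<le> M * exp (e / 2 * (x \<bullet> x))"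
      and N: "N \<ge> 0" "\<And>x. \<bar>g x\<bar> \<le> N * exp (e / 2 * (x \<bullet> x))"
    by blast
  have "\<bar>f x * g x\<bar> \<le> (M * N) * exp (e * (x \<bullet> x))" for x
  proof -
    have "\<bar>f x * g x\<bar> \<le> (M * exp (e / 2 * (x \<bullet> x))) * (N * exp (e / 2 * (x \<bullet> x)))"
      unfolding abs_mult using M(1) by (intro mult_mono M(2) N(2)) auto
    also have "\<dots> = (M * N) * exp (e / 2 * (x \<bullet> x) + e / 2 * (x \<bullet> x))"
      by (simp only: exp_add mult_ac)
    finally show ?thesis
      by simp
  qed
  then show ?case
    using M(1) N(1) by (intro exI[of _ "M * N"]) auto
qed

text \<open>One integrable majorant for all translates by vectors of norm at most \<open>R\<close>,
  as dominated convergence requires. Half of the exponent absorbs the polynomial; the rest is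
  compared with \<open>x\<close> through \<open>norm (x - 2 *\<^sub>R w) \<ge> 0\<close>, which
  leaves the rate 1/8.\<close>

lemma gauss_poly_shift_bound:
  fixes g :: "'v::euclidean_space \<Rightarrow> real"
  assumes "gauss_poly g"
  obtains M where "\<And>x w. norm w \<le> R \<Longrightarrow> \<bar>g (x - w)\<bar> \<le> M * exp (- (x \<bullet> x) / 8)"
proof -
  obtain p where p: "real_polynomial_function p" and g: "g = (\<lambda>x. p x * exp (- (x \<bullet> x) / 2))"
    using assms by (auto simp: gauss_poly_def)
  obtain M where M: "M \<ge> 0" "\<And>x. \<bar>p x\<bar> \<le> M * exp (1/4 * (x \<bullet> x))"
    using real_polynomial_function_le_exp[OF p, of "1/4"] by auto
  show thesis
  proof (rule that[of "M * exp (R\<^sup>2 / 4)"])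
    fix x w :: 'v assume "norm w \<le> R"
    then have wR: "w \<bullet> w \<le> R\<^sup>2"
      by (metis norm_ge_zero power2_norm_eq_inner power_mono)
    let ?y = "x - w"
    have "(x - 2 *\<^sub>R w) \<bullet> (x - 2 *\<^sub>R w) = x \<bullet> x - 4 * (w \<bullet> x) + 4 * (w \<bullet> w)"
      "?y \<bullet> ?y = x \<bullet> x - 2 * (w \<bullet> x) + w \<bullet> w"
      by (simp_all add: inner_diff_left inner_diff_right inner_commute)
    moreover have "0 \<le> (x - 2 *\<^sub>R w) \<bullet> (x - 2 *\<^sub>R w)"
      by simp
    ultimately have "- (?y \<bullet> ?y) / 4 \<le> w \<bullet> w / 4 - (x \<bullet> x) / 8"
      by linarith
    then have le: "- (?y \<bullet> ?y) / 4 \<le> R\<^sup>2 / 4 + - (x \<bullet> x) / 8"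
      using wR by simp
    have "\<bar>g ?y\<bar> \<le> M * exp (1/4 * (?y \<bullet> ?y)) * exp (- (?y \<bullet> ?y) / 2)"
      unfolding g abs_mult using M(2)[of ?y] by simp
    also have "\<dots> = M * exp (1/4 * (?y \<bullet> ?y) + - (?y \<bullet> ?y) / 2)"
      by (simp only: exp_add mult.assoc)
    also have "1/4 * (?y \<bullet> ?y) + - (?y \<bullet> ?y) / 2 = - (?y \<bullet> ?y) / 4"
      by simp
    also have "M * exp (- (?y \<bullet> ?y) / 4) \<le> M * exp (R\<^sup>2 / 4 + - (x \<bullet> x) / 8)"
      using le M(1) by (intro mult_left_mono) auto
    finally show "\<bar>g ?y\<bar> \<le> M * exp (R\<^sup>2 / 4) * exp (- (x \<bullet> x) / 8)"
      by (simp only: exp_add mult.assoc)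
  qed
qed

section \<open>Integrability, and differentiation under the integral sign\<close>

lemma integrable_gaussian:
  assumes c: "c > 0"
  shows "integrable lborel (\<lambda>x::'v::euclidean_space. exp (- (x \<bullet> x) / c))"
proof (rule integrableI_bounded)
  let ?f = "\<lambda>x::real. exp (- x\<^sup>2 / c)"
  \<comment> \<open>In one variable this is a normal density of variance \<open>c / 2\<close> with
    its normalizing factor removed; the general case is a product over coordinates.\<close>
  have "integrable lborel (\<lambda>x. sqrt (pi * c) * normal_density 0 (sqrt (c / 2)) x)"
    using c by (intro integrable_mult_right) simp
  also have "(\<lambda>x. sqrt (pi * c) * normal_density 0 (sqrt (c / 2)) x) = ?f"
    using c by (auto simp: normal_density_def fun_eq_iff)
  finally have 1: "(\<integral>\<^sup>+x. ennreal (?f x) \<partial>lborel) < \<infinity>"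
    by (auto simp: integrable_iff_bounded)
  have eq: "ennreal (norm (exp (- (x \<bullet> x) / c))) = (\<Prod>b\<in>Basis. ennreal (?f (x \<bullet> b)))" for x :: 'v
  proof -
    have "- (x \<bullet> x) / c = (\<Sum>b\<in>Basis. - (x \<bullet> b)\<^sup>2 / c)"
      by (subst euclidean_inner) (simp add: power2_eq_square sum_divide_distrib sum_negf)
    then have "exp (- (x \<bullet> x) / c) = (\<Prod>b\<in>Basis. ?f (x \<bullet> b))"
      by (simp add: exp_sum)
    then show ?thesis
      by (simp add: prod_ennreal prod_nonneg)
  qed
  have "(\<integral>\<^sup>+(x::'v). (\<Prod>b\<in>Basis. ennreal (?f (x \<bullet> b))) \<partial>lborel) =
      (\<Prod>b\<in>(Basis::'v set). (\<integral>\<^sup>+x. ennreal (?f x) \<partial>lborel))"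
    by (rule nn_integral_lborel_prod) auto
  also have "\<dots> < \<infinity>"
    using 1 by (auto simp: power_less_top_ennreal)
  finally show "(\<integral>\<^sup>+(x::'v). ennreal (norm (exp (- (x \<bullet> x) / c))) \<partial>lborel) < \<infinity>"
    unfolding eq .
qed auto

lemma continuous_on_gauss_poly:
  assumes "gauss_poly (g :: 'v::euclidean_space \<Rightarrow> real)"
  shows "continuous_on UNIV g"
proof -
  obtain p where p: "real_polynomial_function p" and g: "g = (\<lambda>x. p x * exp (- (x \<bullet> x) / 2))"
    using assms by (auto simp: gauss_poly_def)
  have "continuous_on UNIV p"
    using p by (intro continuous_on_polymonial_function) (simp flip: real_polynomial_function_eq)
  then show ?thesis
    unfolding g by (intro continuous_intros) auto
qed

lemmas gauss_poly_measurable = borel_measurable_continuous_onI[OF continuous_on_gauss_poly]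

text \<open>The translation by \<open>w\<close> acts on the smooth factor \<open>g\<close>, so that
  differentiation in \<open>w\<close> never touches the discontinuous \<open>k\<close>.\<close>

definition conv_against :: "('v::euclidean_space \<Rightarrow> real) \<Rightarrow> ('v \<Rightarrow> real) \<Rightarrow> 'v \<Rightarrow> real" where
  "conv_against k g w = (\<integral>x. k x * g (x - w) \<partial>lborel)"

context
  fixes k :: "'v::euclidean_space \<Rightarrow> real"
  assumes k_meas: "k \<in> borel_measurable borel" and k_le: "\<And>x. \<bar>k x\<bar> \<le> 1"
begin

lemma integrable_conv_against:
  assumes g: "gauss_poly g"
  shows "integrable lborel (\<lambda>x. k x * g (x - w))"
proof -
  note [measurable] = k_meas gauss_poly_measurable[OF g]
  obtain M where M: "\<And>x w'. norm w' \<le> norm w \<Longrightarrow> \<bar>g (x - w')\<bar> \<le> M * exp (- (x \<bullet> x) / 8)"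
    using gauss_poly_shift_bound[OF g, of "norm w"] by blast
  show ?thesis
  proof (rule Bochner_Integration.integrable_bound)
    show "integrable lborel (\<lambda>x::'v. M * exp (- (x \<bullet> x) / 8))"
      by (intro integrable_mult_right integrable_gaussian) simp
    show "(\<lambda>x. k x * g (x - w)) \<in> borel_measurable lborel"
      by measurable
    show "AE x in lborel. norm (k x * g (x - w)) \<le> norm (M * exp (- (x \<bullet> x) / 8))"
    proof (intro AE_I2)
      fix x :: 'v
      have "\<bar>k x\<bar> * \<bar>g (x - w)\<bar> \<le> 1 * (M * exp (- (x \<bullet> x) / 8))"
        by (intro mult_mono k_le M) auto
      then show "norm (k x * g (x - w)) \<le> norm (M * exp (- (x \<bullet> x) / 8))"
        unfolding real_norm_def abs_mult[of "k x"] by linarith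
    qed
  qed
qed

lemma conv_against_tendsto:
  assumes g: "gauss_poly g" and W: "W \<longlonglongrightarrow> w"
  shows "(\<lambda>i. conv_against k g (W i)) \<longlonglongrightarrow> conv_against k g w"
proof -
  note [measurable] = k_meas gauss_poly_measurable[OF g]
  obtain R where R: "\<And>i. norm (W i) \<le> R"
    using W by (meson convergent_imp_Bseq convergentI BseqD)
  obtain M where M: "\<And>x w'. norm w' \<le> R \<Longrightarrow> \<bar>g (x - w')\<bar> \<le> M * exp (- (x \<bullet> x) / 8)"
    using gauss_poly_shift_bound[OF g, of R] by blast
  note cont = continuous_on_gauss_poly[OF g]
  show ?thesis
    unfolding conv_against_def
  proof (rule integral_dominated_convergence)
    show "integrable lborel (\<lambda>x::'v. M * exp (- (x \<bullet> x) / 8))"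
      by (intro integrable_mult_right integrable_gaussian) simp
    show "AE x in lborel. (\<lambda>i. k x * g (x - W i)) \<longlonglongrightarrow> k x * g (x - w)"
      using continuous_on_tendsto_compose[OF cont tendsto_diff[OF tendsto_const W]]
      by (intro AE_I2 tendsto_mult tendsto_const) auto
    show "AE x in lborel. norm (k x * g (x - W i)) \<le> M * exp (- (x \<bullet> x) / 8)" for i
    proof (intro AE_I2)
      fix x :: 'v
      have "\<bar>k x\<bar> * \<bar>g (x - W i)\<bar> \<le> 1 * (M * exp (- (x \<bullet> x) / 8))"
        by (intro mult_mono k_le M R) auto
      then show "norm (k x * g (x - W i)) \<le> M * exp (- (x \<bullet> x) / 8)"
        by (simp add: abs_mult)
    qed
  qed measurable
qed

text \<open>Dominated convergence for the difference quotients: the mean value theorem rewrites each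
  as a value of \<open>g'\<close> at a nearby translate, where the common Gaussian bound applies.
  The direction is \<open>- u\<close> because \<open>w\<close> enters through
  \<open>x - w\<close>.\<close>

lemma conv_against_has_derivative:
  assumes g: "gauss_poly g" and g': "gauss_poly g'"
    and d: "\<And>x t. ((\<lambda>t. g (x + t *\<^sub>R (- u))) has_real_derivative g' (x + t *\<^sub>R (- u))) (at t)"
  shows "((\<lambda>t. conv_against k g (w + t *\<^sub>R u)) has_real_derivative conv_against k g' w) (at 0)"
  unfolding DERIV_def tendsto_at_iff_sequentially comp_def
proof (intro allI impI)
  fix h :: "nat \<Rightarrow> real" assume h0: "\<forall>i. h i \<in> UNIV - {0}" and h: "h \<longlonglongrightarrow> 0"
  note [measurable] = k_meas gauss_poly_measurable[OF g] gauss_poly_measurable[OF g']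
  obtain r where r: "\<And>i. norm (h i) \<le> r"
    using h by (meson convergent_imp_Bseq convergentI BseqD)
  define R where "R = norm w + r * norm u"
  obtain M where M: "\<And>x w'. norm w' \<le> R \<Longrightarrow> \<bar>g' (x - w')\<bar> \<le> M * exp (- (x \<bullet> x) / 8)"
    using gauss_poly_shift_bound[OF g', of R] by blast
  define q where "q i x = (g (x - (w + h i *\<^sub>R u)) - g (x - w)) / h i" for i x
  have q_le: "\<bar>q i x\<bar> \<le> M * exp (- (x \<bullet> x) / 8)" for i x
  proof -
    \<comment> \<open>The increment may have either sign, and the mean value theorem is applied on
      the interval between 0 and \<open>h i\<close> in each case.\<close>
    obtain s where s: "\<bar>s\<bar> \<le> \<bar>h i\<bar>" "q i x = g' (x - w + s *\<^sub>R (- u))"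
    proof (cases "h i > 0")
      case True
      then obtain s where "s > 0" "s < h i"
        "g (x - w + h i *\<^sub>R (- u)) - g (x - w + 0 *\<^sub>R (- u)) = (h i - 0) * g' (x - w + s *\<^sub>R (- u))"
        using MVT2[of 0 "h i" "\<lambda>t. g (x - w + t *\<^sub>R (- u))" "\<lambda>t. g' (x - w + t *\<^sub>R (- u))"] d by blast
      then show thesis
        using True by (intro that[of s]) (auto simp: q_def diff_diff_eq)
    next
      case False
      then have neg: "h i < 0"
        using h0 by (metis Diff_iff insertI1 less_linear)
      then obtain s where "s > h i" "s < 0"
        "g (x - w + 0 *\<^sub>R (- u)) - g (x - w + h i *\<^sub>R (- u)) = (0 - h i) * g' (x - w + s *\<^sub>R (- u))"
        using MVT2[of "h i" 0 "\<lambda>t. g (x - w + t *\<^sub>R (- u))" "\<lambda>t. g' (x - w + t *\<^sub>R (- u))"] d by blast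
      then show thesis
        using neg by (intro that[of s]) (auto simp: q_def diff_diff_eq field_simps)
    qed
    have "norm (w + s *\<^sub>R u) \<le> norm w + norm (s *\<^sub>R u)"
      by (rule norm_triangle_ineq)
    also have "norm (s *\<^sub>R u) \<le> r * norm u"
      using s(1) r[of i] by (simp add: mult_right_mono)
    finally have "norm (w + s *\<^sub>R u) \<le> R"
      by (simp add: R_def)
    then show ?thesis
      using M[of "w + s *\<^sub>R u" x] s(2) by (simp add: diff_diff_eq)
  qed
  have q_lim: "(\<lambda>i. q i x) \<longlonglongrightarrow> g' (x - w)" for x
  proof -
    have "((\<lambda>t. g (x - w + t *\<^sub>R (- u))) has_real_derivative g' (x - w)) (at 0)"
      using d[of "x - w" 0] by simp
    then have "(\<lambda>i. (g (x - w + (0 + h i) *\<^sub>R (- u)) - g (x - w + 0 *\<^sub>R (- u))) / h i) \<longlonglongrightarrow> g' (x - w)"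
      unfolding DERIV_def tendsto_at_iff_sequentially comp_def using h0 h by blast
    then show ?thesis
      by (simp add: q_def[abs_def] diff_diff_eq)
  qed
  have "(\<lambda>i. \<integral>x. k x * q i x \<partial>lborel) \<longlonglongrightarrow> (\<integral>x. k x * g' (x - w) \<partial>lborel)"
  proof (rule integral_dominated_convergence)
    show "integrable lborel (\<lambda>x::'v. M * exp (- (x \<bullet> x) / 8))"
      by (intro integrable_mult_right integrable_gaussian) simp
    show "AE x in lborel. (\<lambda>i. k x * q i x) \<longlonglongrightarrow> k x * g' (x - w)"
      by (intro AE_I2 tendsto_mult tendsto_const q_lim)
    show "AE x in lborel. norm (k x * q i x) \<le> M * exp (- (x \<bullet> x) / 8)" for i
    proof (intro AE_I2)
      fix x :: 'v
      have "\<bar>k x\<bar> * \<bar>q i x\<bar> \<le> 1 * (M * exp (- (x \<bullet> x) / 8))"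
        by (intro mult_mono k_le q_le) auto
      then show "norm (k x * q i x) \<le> M * exp (- (x \<bullet> x) / 8)"
        by (simp add: abs_mult)
    qed
  qed (simp_all add: q_def, measurable)
  moreover have "(\<integral>x. k x * q i x \<partial>lborel) =
      (conv_against k g (w + h i *\<^sub>R u) - conv_against k g w) / h i" for i
  proof -
    have "(\<integral>x. k x * q i x \<partial>lborel) =
        (\<integral>x. (k x * g (x - (w + h i *\<^sub>R u)) - k x * g (x - w)) / h i \<partial>lborel)"
      by (simp add: q_def right_diff_distrib diff_divide_distrib)
    also have "\<dots> = (\<integral>x. k x * g (x - (w + h i *\<^sub>R u)) - k x * g (x - w) \<partial>lborel) / h i"
      by simp
    also have "(\<integral>x. k x * g (x - (w + h i *\<^sub>R u)) - k x * g (x - w) \<partial>lborel) =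
        conv_against k g (w + h i *\<^sub>R u) - conv_against k g w"
      unfolding conv_against_def
      by (intro Bochner_Integration.integral_diff integrable_conv_against g)
    finally show ?thesis .
  qed
  ultimately show "(\<lambda>i. (conv_against k g (w + (0 + h i) *\<^sub>R u) - conv_against k g (w + 0 *\<^sub>R u)) / h i)
      \<longlonglongrightarrow> conv_against k g' w"
    by (simp add: conv_against_def[of k g'])
qed

end

section \<open>Iterated partial derivatives and mixed differences\<close>

text \<open>A global form of \<open>has_iterated_partial\<close>: the derivatives exist at every
  point, so the mean value theorem can be used along whole lines.\<close>

primrec iter_partial :: "'n list \<Rightarrow> (real^'n \<Rightarrow> real) \<Rightarrow> (real^'n \<Rightarrow> real) \<Rightarrow> bool" where
  "iter_partial [] \<Phi> \<Psi> \<longleftrightarrow> \<Psi> = \<Phi>"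
| "iter_partial (j # js) \<Phi> \<Psi> \<longleftrightarrow> (\<exists>\<Psi>'. iter_partial js \<Phi> \<Psi>' \<and>
     (\<forall>b. ((\<lambda>t. \<Psi>' (b + t *\<^sub>R axis j 1)) has_real_derivative \<Psi> b) (at 0)))"

lemma iter_partial_imp_has_iterated_partial:
  "iter_partial js \<Phi> \<Psi> \<Longrightarrow> has_iterated_partial js \<Phi> b (\<Psi> b)"
proof (induction js arbitrary: \<Psi> b)
  case (Cons j js)
  then show ?case
    by (auto intro!: always_eventually)
qed simp

lemma iter_partial_sum:
  assumes "\<And>F. F \<in> K \<Longrightarrow> iter_partial js (\<Phi> F) (\<Psi> F)"
  shows "iter_partial js (\<lambda>b. \<Sum>F\<in>K. \<Phi> F b) (\<lambda>b. \<Sum>F\<in>K. \<Psi> F b)"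
  using assms
proof (induction js arbitrary: \<Psi>)
  case Nil
  then show ?case
    by (auto intro!: ext sum.cong)
next
  case (Cons j js)
  then have "\<forall>F\<in>K. \<exists>\<Psi>'. iter_partial js (\<Phi> F) \<Psi>' \<and>
      (\<forall>b. ((\<lambda>t. \<Psi>' (b + t *\<^sub>R axis j 1)) has_real_derivative \<Psi> F b) (at 0))"
    by simp
  then obtain \<Psi>' where 1: "\<And>F. F \<in> K \<Longrightarrow> iter_partial js (\<Phi> F) (\<Psi>' F)"
    and 2: "\<And>F b. F \<in> K \<Longrightarrow> ((\<lambda>t. \<Psi>' F (b + t *\<^sub>R axis j 1)) has_real_derivative \<Psi> F b) (at 0)"
    by metis
  show ?case
    using Cons.IH[of \<Psi>', OF 1] 2
    by (auto intro!: exI[of _ "\<lambda>b. \<Sum>F\<in>K. \<Psi>' F b"] DERIV_sum)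
qed

lemma iter_partial_diff:
  assumes "iter_partial js \<Phi> \<Psi>"
  shows "iter_partial js (\<lambda>b. \<Phi> (b + v) - \<Phi> b) (\<lambda>b. \<Psi> (b + v) - \<Psi> b)"
  using assms
proof (induction js arbitrary: \<Psi>)
  case (Cons j js)
  then obtain \<Psi>' where 1: "iter_partial js \<Phi> \<Psi>'"
    and 2: "\<And>b. ((\<lambda>t. \<Psi>' (b + t *\<^sub>R axis j 1)) has_real_derivative \<Psi> b) (at 0)"
    by auto
  have "((\<lambda>t. \<Psi>' (b + t *\<^sub>R axis j 1 + v) - \<Psi>' (b + t *\<^sub>R axis j 1)) has_real_derivative
      \<Psi> (b + v) - \<Psi> b) (at 0)" for b
    using DERIV_diff[OF 2[of "b + v"] 2[of b]] by (simp add: add_ac)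
  then show ?case
    using Cons.IH[OF 1] by auto
qed simp

text \<open>The head of the list is the first difference applied to \<open>\<Phi>\<close>, whereas
  in \<open>iter_partial\<close> it is the last derivative taken. This lets the induction for the
  mean value theorem differentiate a difference and then resolve that difference.\<close>

primrec mixed_diff :: "'n list \<Rightarrow> real \<Rightarrow> (real^'n \<Rightarrow> real) \<Rightarrow> real^'n \<Rightarrow> real" where
  "mixed_diff [] h \<Phi> = \<Phi>"
| "mixed_diff (j # js) h \<Phi> = mixed_diff js h (\<lambda>b. \<Phi> (b + h *\<^sub>R axis j 1) - \<Phi> b)"

text \<open>Since differences commute with derivatives, the induction hypothesis applied to the
  difference in direction \<open>j\<close> leaves a difference of \<open>\<Psi>'\<close> over one
  step \<open>h\<close>; a final mean value theorem moves the point by less than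
  \<open>h\<close>.\<close>

lemma mixed_diff_mvt:
  assumes "iter_partial js \<Phi> \<Psi>" "h > 0"
  shows "\<exists>\<xi>. norm (\<xi> - b) \<le> real (length js) * h \<and> mixed_diff js h \<Phi> b = h ^ length js * \<Psi> \<xi>"
  using assms
proof (induction js arbitrary: \<Phi> \<Psi>)
  case Nil
  then show ?case
    by (auto intro: exI[of _ b])
next
  case (Cons j js)
  then obtain \<Psi>' where 1: "iter_partial js \<Phi> \<Psi>'"
    and 2: "\<And>b. ((\<lambda>t. \<Psi>' (b + t *\<^sub>R axis j 1)) has_real_derivative \<Psi> b) (at 0)"
    by auto
  obtain \<xi> where \<xi>: "norm (\<xi> - b) \<le> real (length js) * h"
    and eq: "mixed_diff (j # js) h \<Phi> b = h ^ length js * (\<Psi>' (\<xi> + h *\<^sub>R axis j 1) - \<Psi>' \<xi>)"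
    unfolding mixed_diff.simps using Cons.IH[OF iter_partial_diff[OF 1] \<open>h > 0\<close>] by blast
  \<comment> \<open>The derivative is given only at parameter 0, but for every base point; moving
    the base point yields it along the whole line.\<close>
  have deriv: "((\<lambda>t. \<Psi>' (\<xi> + t *\<^sub>R axis j 1)) has_real_derivative \<Psi> (\<xi> + s *\<^sub>R axis j 1)) (at s)" for s
  proof -
    have "((\<lambda>t. \<Psi>' (\<xi> + (t + s) *\<^sub>R axis j 1)) has_real_derivative \<Psi> (\<xi> + s *\<^sub>R axis j 1)) (at 0)"
      using 2[of "\<xi> + s *\<^sub>R axis j 1"] by (simp add: scaleR_left_distrib add_ac)
    then show ?thesis
      using DERIV_shift[of "\<lambda>t. \<Psi>' (\<xi> + t *\<^sub>R axis j 1)" "\<Psi> (\<xi> + s *\<^sub>R axis j 1)" 0 s]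
      by (simp only: add_0_left)
  qed
  obtain s where s: "0 < s" "s < h"
    and mv: "\<Psi>' (\<xi> + h *\<^sub>R axis j 1) - \<Psi>' (\<xi> + 0 *\<^sub>R axis j 1) = (h - 0) * \<Psi> (\<xi> + s *\<^sub>R axis j 1)"
    using MVT2[OF \<open>h > 0\<close> deriv] by blast
  have "norm (\<xi> + s *\<^sub>R axis j 1 - b) \<le> norm (\<xi> - b) + norm (s *\<^sub>R axis j (1::real))"
    using norm_triangle_ineq[of "\<xi> - b" "s *\<^sub>R axis j 1"] by (simp add: algebra_simps)
  also have "\<dots> \<le> real (length (j # js)) * h"
    using \<xi> s by (simp add: algebra_simps)
  finally have "norm (\<xi> + s *\<^sub>R axis j 1 - b) \<le> real (length (j # js)) * h" .
  moreover have "mixed_diff (j # js) h \<Phi> b = h ^ length (j # js) * \<Psi> (\<xi> + s *\<^sub>R axis j 1)"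
    unfolding eq using mv by simp
  ultimately show ?case
    by blast
qed

text \<open>The intermediate point lies within a multiple of \<open>h\<close> of \<open>b\<close>,
  so continuity of \<open>\<Psi>\<close> at \<open>b\<close> suffices. Derivatives can thus be read
  off from differences of the discontinuous integrand.\<close>

lemma mixed_diff_quotient_tendsto:
  assumes "iter_partial js \<Phi> \<Psi>" "isCont \<Psi> b"
  shows "((\<lambda>h. mixed_diff js h \<Phi> b / h ^ length js) \<longlongrightarrow> \<Psi> b) (at_right 0)"
proof -
  have "\<forall>h. \<exists>\<xi>. h > 0 \<longrightarrow>
      norm (\<xi> - b) \<le> real (length js) * h \<and> mixed_diff js h \<Phi> b = h ^ length js * \<Psi> \<xi>"
    using mixed_diff_mvt[OF assms(1)] by blast
  from choice[OF this] obtain \<xi> where ex: "\<forall>h>0. norm (\<xi> h - b) \<le> real (length js) * h \<and>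
      mixed_diff js h \<Phi> b = h ^ length js * \<Psi> (\<xi> h)"
    by (rule exE)
  have \<xi>: "norm (\<xi> h - b) \<le> real (length js) * h" "mixed_diff js h \<Phi> b = h ^ length js * \<Psi> (\<xi> h)"
    if "h > 0" for h
    using ex that by simp_all
  have pos: "\<forall>\<^sub>F h in at_right 0. (0::real) < h"
    by (rule eventually_at_right_less)
  have "((\<lambda>h. \<xi> h - b) \<longlongrightarrow> 0) (at_right 0)"
  proof (rule Lim_null_comparison)
    show "\<forall>\<^sub>F h in at_right 0. norm (\<xi> h - b) \<le> real (length js) * h"
      using pos by eventually_elim (rule \<xi>)
    have "((\<lambda>h. real (length js) * h) \<longlongrightarrow> real (length js) * 0) (at_right (0::real))"
      by (intro tendsto_intros)
    then show "((\<lambda>h. real (length js) * h) \<longlongrightarrow> 0) (at_right (0::real))"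
      by simp
  qed
  then have "(\<xi> \<longlongrightarrow> b) (at_right 0)"
    by (simp add: LIM_zero_iff)
  then have "((\<lambda>h. \<Psi> (\<xi> h)) \<longlongrightarrow> \<Psi> b) (at_right 0)"
    by (rule isCont_tendsto_compose[OF assms(2)])
  moreover have "\<forall>\<^sub>F h in at_right 0. \<Psi> (\<xi> h) = mixed_diff js h \<Phi> b / h ^ length js"
    using pos by eventually_elim (simp add: \<xi>(2))
  ultimately show ?thesis
    by (rule Lim_transform_eventually)
qed

text \<open>Each difference at most doubles the bound and uses points at most \<open>h\<close>
  farther away.\<close>

lemma mixed_diff_bound:
  assumes "h \<ge> 0" "\<And>c. norm (c - b) \<le> real (length js) * h \<Longrightarrow> \<bar>\<Phi> c\<bar> \<le> M"
  shows "\<bar>mixed_diff js h \<Phi> b\<bar> \<le> 2 ^ length js * M"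
  using assms(2)
proof (induction js arbitrary: \<Phi> M)
  case (Cons j js)
  have "\<bar>\<Phi> (c + h *\<^sub>R axis j 1) - \<Phi> c\<bar> \<le> 2 * M" if c: "norm (c - b) \<le> real (length js) * h" for c
  proof -
    have "norm (c + h *\<^sub>R axis j 1 - b) \<le> norm (c - b) + norm (h *\<^sub>R axis j (1::real))"
      using norm_triangle_ineq[of "c - b" "h *\<^sub>R axis j 1"] by (simp add: algebra_simps)
    then have "\<bar>\<Phi> (c + h *\<^sub>R axis j 1)\<bar> \<le> M" "\<bar>\<Phi> c\<bar> \<le> M"
      using c assms(1) by (auto intro!: Cons.prems simp: algebra_simps)
    then show ?thesis
      by linarith
  qed
  then have "\<bar>mixed_diff js h (\<lambda>b. \<Phi> (b + h *\<^sub>R axis j 1) - \<Phi> b) b\<bar> \<le> 2 ^ length js * (2 * M)"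
    by (rule Cons.IH)
  then show ?case
    by (simp add: mult_ac)
qed simp

section \<open>Computing mixed differences of sums, integrals and products\<close>

lemma mixed_diff_sum:
  "mixed_diff js h (\<lambda>b. \<Sum>F\<in>K. \<Phi> F b) b = (\<Sum>F\<in>K. mixed_diff js h (\<Phi> F) b)"
  by (induction js arbitrary: \<Phi>) (simp_all flip: sum_subtractf)

lemma mixed_diff_integral:
  assumes "\<And>b. integrable N (\<lambda>x. s b x)"
  shows "mixed_diff js h (\<lambda>b. \<integral>x. s b x \<partial>N) b = (\<integral>x. mixed_diff js h (\<lambda>b. s b x) b \<partial>N)"
  using assms
proof (induction js arbitrary: s)
  case (Cons j js)
  then have "(\<integral>x. s (b + h *\<^sub>R axis j 1) x \<partial>N) - (\<integral>x. s b x \<partial>N) =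
      (\<integral>x. s (b + h *\<^sub>R axis j 1) x - s b x \<partial>N)" for b
    by (intro Bochner_Integration.integral_diff[symmetric])
  then show ?case
    using Cons.IH[of "\<lambda>b x. s (b + h *\<^sub>R axis j 1) x - s b x"] Cons.prems by simp
qed simp

lemma mixed_diff_cmult:
  "mixed_diff js h (\<lambda>b. c * \<Phi> b) b = c * mixed_diff js h \<Phi> b"
  by (induction js arbitrary: \<Phi>) (simp_all flip: right_diff_distrib)

lemma mixed_diff_zero: "mixed_diff js h (\<lambda>b. 0) b = 0"
  by (induction js) simp_all

text \<open>The difference in direction \<open>j\<close> gives zero, and any differences taken
  before it preserve independence of the coordinate \<open>j\<close>.\<close>

lemma mixed_diff_independent:
  assumes "j \<in> set js" "\<And>b t. \<Phi> (b + t *\<^sub>R axis j 1) = \<Phi> b"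
  shows "mixed_diff js h \<Phi> b = 0"
  using assms
proof (induction js arbitrary: \<Phi>)
  case (Cons i js)
  show ?case
  proof (cases "i = j")
    case True
    then show ?thesis
      using Cons.prems by (simp add: mixed_diff_zero)
  next
    case False
    have "\<Phi> (b + t *\<^sub>R axis j 1 + h *\<^sub>R axis i 1) = \<Phi> (b + h *\<^sub>R axis i 1)" for b t
      using Cons.prems(2)[of "b + h *\<^sub>R axis i 1" t] by (simp add: add_ac)
    then show ?thesis
      using Cons False by simp
  qed
qed simp

text \<open>Each difference acts on its own factor only. The factor \<open>c\<close> collects the
  factors already differenced, which are constant in the remaining directions.\<close>

lemma mixed_diff_prod:
  assumes "distinct js" "\<And>i b t. i \<in> set js \<Longrightarrow> c (b + t *\<^sub>R axis i 1) = c b"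
  shows "mixed_diff js h (\<lambda>b. c b * (\<Prod>i\<in>set js. q i (b $ i))) b =
    c b * (\<Prod>i\<in>set js. q i (b $ i + h) - q i (b $ i))"
  using assms
proof (induction js arbitrary: c)
  case (Cons j js)
  let ?e = "\<lambda>i. axis i (1::real)"
  have other: "(b + t *\<^sub>R ?e j) $ i = b $ i" if "i \<noteq> j" for i j b t
    using that by (simp add: axis_def)
  have prod_shift: "(\<Prod>i\<in>set js. q i ((b + h *\<^sub>R ?e j) $ i)) = (\<Prod>i\<in>set js. q i (b $ i))" for b
    using Cons.prems(1) by (intro prod.cong) (auto simp: axis_def)
  have "c (b + h *\<^sub>R ?e j) * (\<Prod>i\<in>set (j # js). q i ((b + h *\<^sub>R ?e j) $ i)) -
      c b * (\<Prod>i\<in>set (j # js). q i (b $ i)) =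
      c b * (q j (b $ j + h) - q j (b $ j)) * (\<Prod>i\<in>set js. q i (b $ i))" for b
    using Cons.prems prod_shift by (simp add: axis_def algebra_simps)
  then have "mixed_diff (j # js) h (\<lambda>b. c b * (\<Prod>i\<in>set (j # js). q i (b $ i))) b =
      mixed_diff js h (\<lambda>b. c b * (q j (b $ j + h) - q j (b $ j)) * (\<Prod>i\<in>set js. q i (b $ i))) b"
    by (simp only: mixed_diff.simps)
  also have "\<dots> = c b * (q j (b $ j + h) - q j (b $ j)) * (\<Prod>i\<in>set js. q i (b $ i + h) - q i (b $ i))"
  proof (rule Cons.IH)
    show "c (b + t *\<^sub>R ?e i) * (q j ((b + t *\<^sub>R ?e i) $ j + h) - q j ((b + t *\<^sub>R ?e i) $ j)) =
        c b * (q j (b $ j + h) - q j (b $ j))" if "i \<in> set js" for i b t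
    proof -
      have "(b + t *\<^sub>R ?e i) $ j = b $ j"
        using that Cons.prems(1) by (intro other) auto
      then show ?thesis
        using that Cons.prems(2)[of i b t] by (simp only:) simp
    qed
  qed (use Cons.prems in simp)
  finally show ?case
    using Cons.prems(1) by (simp add: mult_ac)
qed simp

text \<open>By linearity of \<open>L\<close>, a step along \<open>axis j 1\<close> translates along
  \<open>L (axis j 1)\<close>. Each derivative therefore replaces \<open>g\<close> by another member
  of \<open>gauss_poly\<close>, with the same \<open>k\<close>.\<close>

lemma conv_against_iter_partial:
  fixes L :: "real^'n \<Rightarrow> 'v::euclidean_space"
  assumes k: "k \<in> borel_measurable borel" "\<And>x. \<bar>k x\<bar> \<le> 1" and L: "linear L" and g: "gauss_poly g"
  shows "\<exists>g'. gauss_poly g' \<and>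
    iter_partial js (\<lambda>b. conv_against k g (L b)) (\<lambda>b. conv_against k g' (L b))"
proof (induction js)
  case Nil
  then show ?case
    using g by auto
next
  case (Cons j js)
  then obtain g1 where g1: "gauss_poly g1"
    and ip: "iter_partial js (\<lambda>b. conv_against k g (L b)) (\<lambda>b. conv_against k g1 (L b))"
    by blast
  obtain g2 where g2: "gauss_poly g2" and
    d: "\<And>x t. ((\<lambda>t. g1 (x + t *\<^sub>R - L (axis j 1))) has_real_derivative g2 (x + t *\<^sub>R - L (axis j 1))) (at t)"
    using gauss_poly_has_directional_derivative[OF g1] by blast
  have "L (b + t *\<^sub>R axis j 1) = L b + t *\<^sub>R L (axis j 1)" for b t
    using L by (simp add: linear_add linear_scale)
  then show ?case
    using g2 ip conv_against_has_derivative[OF k g1 g2 d] by (auto intro!: exI[of _ g2])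
qed

lemma conv_against_isCont:
  fixes L :: "real^'n \<Rightarrow> 'v::euclidean_space"
  assumes k: "k \<in> borel_measurable borel" "\<And>x. \<bar>k x\<bar> \<le> 1" and L: "linear L" and g: "gauss_poly g"
  shows "isCont (\<lambda>b. conv_against k g (L b)) b"
  unfolding isCont_def tendsto_at_iff_sequentially comp_def
proof (intro allI impI)
  fix X assume "X \<longlonglongrightarrow> b"
  then show "(\<lambda>i. conv_against k g (L (X i))) \<longlonglongrightarrow> conv_against k g (L b)"
    using conv_against_tendsto[OF k g] linear_continuous_at[of L b] L
    by (auto intro: isCont_tendsto_compose simp: linear_conv_bounded_linear)
qed

section \<open>Volume of a parallelepiped\<close>

text \<open>
  The change of variables lemma \<open>measure_linear_image\<close> needs a well-ordered index type; this copy of a finite type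
  provides one of the same cardinality.
\<close>

typedef (overloaded) ('a::finite) idx = "{..<CARD('a)}"
  using zero_less_card_finite by blast

instantiation idx :: (finite) wellorder
begin

definition "x \<le> y \<longleftrightarrow> Rep_idx x \<le> Rep_idx y"
definition "x < y \<longleftrightarrow> Rep_idx x < Rep_idx y"

instance
proof
  fix P :: "'a idx \<Rightarrow> bool" and x
  assume step: "\<And>x. (\<And>y. y < x \<Longrightarrow> P y) \<Longrightarrow> P x"
  show "P x"
  proof (induction "Rep_idx x" arbitrary: x rule: less_induct)
    case less
    show ?case
      by (rule step, rule less) (simp add: less_idx_def)
  qed
qed (auto simp: less_eq_idx_def less_idx_def Rep_idx_inject)

end

lemma bij_betw_Rep_idx: "bij_betw Rep_idx (UNIV :: 'a::finite idx set) {..<CARD('a)}"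
  unfolding bij_betw_def
  using type_definition.Rep_range[OF type_definition_idx] by (simp add: inj_on_def Rep_idx_inject)

instance idx :: (finite) finite
  by standard (use bij_betw_finite[OF bij_betw_Rep_idx] in blast)

lemma card_idx: "CARD('a::finite idx) = CARD('a)"
proof -
  have "CARD('a idx) = card {..<CARD('a)}"
    using bij_betw_Rep_idx by (rule bij_betw_same_card)
  then show ?thesis
    by simp
qed

text \<open>Transport of permutations along \<open>\<sigma>\<close> is a bijection that preserves
  the sign.\<close>

lemma det_on_eq_det:
  fixes \<sigma> :: "'m::finite \<Rightarrow> 'n"
  assumes \<sigma>: "bij_betw \<sigma> UNIV J"
  shows "det_on J M = det (\<chi> k l. M (\<sigma> k) (\<sigma> l))"
proof -
  let ?P = "map_permutation UNIV \<sigma>"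
  have inj: "inj \<sigma>"
    using \<sigma> by (simp add: bij_betw_def)
  have inv: "bij_betw (inv_into UNIV \<sigma>) J UNIV"
    using \<sigma> by (rule bij_betw_inv_into)
  have "bij_betw ?P {p. p permutes UNIV} {p. p permutes J}"
  proof (rule bij_betw_byWitness[where f' = "map_permutation J (inv_into UNIV \<sigma>)"])
    show "\<forall>p\<in>{p. p permutes UNIV}. map_permutation J (inv_into UNIV \<sigma>) (?P p) = p"
      using \<sigma> inj by (auto intro!: map_permutation_compose_inv)
    show "\<forall>p\<in>{p. p permutes J}. ?P (map_permutation J (inv_into UNIV \<sigma>) p) = p"
      using map_permutation_compose_inv[OF inv] bij_betw_inv_into_right[OF \<sigma>] by auto
  qed (use \<sigma> inv in \<open>auto intro: map_permutation_permutes\<close>)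
  then have "det_on J M =
      (\<Sum>p | p permutes UNIV. of_int (sign (?P p)) * (\<Prod>i\<in>J. M i (?P p i)))"
    unfolding det_on_def by (subst sum.reindex_bij_betw[symmetric]) auto
  also have "\<dots> = (\<Sum>p | p permutes UNIV. of_int (sign p) * (\<Prod>k\<in>UNIV. M (\<sigma> k) (\<sigma> (p k))))"
  proof (intro sum.cong refl)
    fix p :: "'m \<Rightarrow> 'm" assume "p \<in> {p. p permutes UNIV}"
    then have p: "p permutes UNIV"
      by simp
    have "(\<Prod>i\<in>J. M i (?P p i)) = (\<Prod>k\<in>UNIV. M (\<sigma> k) (?P p (\<sigma> k)))"
      by (rule prod.reindex_bij_betw[OF \<sigma>, symmetric])
    then show "of_int (sign (?P p)) * (\<Prod>i\<in>J. M i (?P p i)) =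
        of_int (sign p) * (\<Prod>k\<in>UNIV. M (\<sigma> k) (\<sigma> (p k)))"
      using inj p by (simp add: sign_map_permutation map_permutation_apply)
  qed
  also have "\<dots> = det (\<chi> k l. M (\<sigma> k) (\<sigma> l))"
    by (simp add: det_def)
  finally show ?thesis .
qed

lemma prod_Basis_vec: "(\<Prod>b\<in>(Basis :: (real^'n) set). f b) = (\<Prod>i\<in>UNIV. f (axis i 1))"
proof -
  have "bij_betw (\<lambda>i. axis i 1) UNIV (Basis :: (real^'n) set)"
    by (auto simp: bij_betw_def inj_on_def Basis_vec_def axis_eq_axis)
  then show ?thesis
    by (rule prod.reindex_bij_betw[symmetric])
qed

text \<open>Lebesgue measure is determined by boxes, and a box pulls back to a box with the same
  side lengths in another order.\<close>

lemma distr_lborel_reindex: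
  fixes \<pi> :: "'m::finite \<Rightarrow> 'd::finite"
  assumes \<pi>: "bij \<pi>"
  shows "distr lborel borel (\<lambda>x::real^'d. \<chi> k. x $ \<pi> k) = (lborel :: (real^'m) measure)"
proof (rule lborel_eqI[symmetric])
  have cont: "continuous_on UNIV (\<lambda>x::real^'d. (\<chi> k. x $ \<pi> k) :: real^'m)"
    by (intro continuous_on_vec_lambda continuous_intros)
  have [measurable]: "(\<lambda>x::real^'d. (\<chi> k. x $ \<pi> k) :: real^'m) \<in> borel_measurable borel"
    using cont by (rule borel_measurable_continuous_onI)
  fix l u :: "real^'m" assume le: "\<And>b. b \<in> Basis \<Longrightarrow> l \<bullet> b \<le> u \<bullet> b"
  define l' u' :: "real^'d" where "l' = (\<chi> i. l $ inv \<pi> i)" and "u' = (\<chi> i. u $ inv \<pi> i)"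
  have lu: "l $ k \<le> u $ k" for k
    using le[of "axis k 1"] by (simp add: inner_axis)
  have eq: "(\<lambda>x::real^'d. (\<chi> k. x $ \<pi> k) :: real^'m) -` box l u = box l' u'"
    using \<pi> by (auto simp: mem_box_cart l'_def u'_def) (metis bij_inv_eq_iff)+
  have "emeasure (distr lborel borel (\<lambda>x::real^'d. \<chi> k. x $ \<pi> k)) (box l u) = emeasure lborel (box l' u')"
    by (subst emeasure_distr) (auto simp: eq)
  also have "\<dots> = ennreal (\<Prod>b\<in>Basis. (u' - l') \<bullet> b)"
    using lu by (intro emeasure_lborel_box) (auto simp: Basis_vec_def inner_axis l'_def u'_def)
  also have "(\<Prod>b\<in>Basis. (u' - l') \<bullet> b) = (\<Prod>i\<in>UNIV. (u - l) $ inv \<pi> i)"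
    by (simp add: prod_Basis_vec inner_axis l'_def u'_def)
  also have "\<dots> = (\<Prod>k\<in>UNIV. (u - l) $ k)"
    by (rule prod.reindex_bij_betw[OF bij_imp_bij_inv[OF \<pi>]])
  also have "\<dots> = (\<Prod>b\<in>Basis. (u - l) \<bullet> b)"
    by (simp add: prod_Basis_vec inner_axis)
  finally show "emeasure (distr lborel borel (\<lambda>x::real^'d. \<chi> k. x $ \<pi> k)) (box l u) =
      (\<Prod>b\<in>Basis. (u - l) \<bullet> b)" .
qed simp

text \<open>The cube is squeezed between an open and a closed box, both of volume 1.\<close>

lemma unit_halfopen_cube:
  defines "B \<equiv> {y::real^'m. \<forall>k. -1 \<le> y $ k \<and> y $ k < 0}"
  shows "B \<in> lmeasurable" "measure lebesgue B = 1" "bounded B"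
proof -
  let ?l = "(\<chi> k. -1) :: real^'m"
  have sub: "box ?l 0 \<subseteq> B" "B \<subseteq> cbox ?l 0"
    by (auto simp: B_def mem_box_cart less_imp_le)
  show "bounded B"
    by (rule bounded_subset[OF bounded_cbox sub(2)])
  have "B = (\<Inter>k. {y. -1 \<le> y $ k \<and> y $ k < 0})"
    by (auto simp: B_def)
  also have "\<dots> \<in> sets borel"
    by measurable
  finally have "B \<in> sets borel" .
  then show lm: "B \<in> lmeasurable"
    using \<open>bounded B\<close> by (intro bounded_set_imp_lmeasurable) auto
  have "0 \<in> cbox ?l 0"
    by (simp add: mem_box_cart)
  then have "cbox ?l 0 \<noteq> {}"
    by blast
  then have "measure lebesgue (cbox ?l 0) = 1"
    by (simp add: content_cbox_cart)
  moreover have "measure lebesgue (box ?l 0) = 1"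
    using calculation by (simp add: measure_lborel_box_eq measure_lborel_cbox_eq)
  moreover have "measure lebesgue (box ?l 0) \<le> measure lebesgue B"
    by (intro measure_mono_fmeasurable sub lm) auto
  moreover have "measure lebesgue B \<le> measure lebesgue (cbox ?l 0)"
    using lm by (intro measure_mono_fmeasurable sub) auto
  ultimately show "measure lebesgue B = 1"
    by simp
qed

text \<open>After relabelling coordinates, the set is the image of the half-open unit cube under the
  inverse of the matrix \<open>M\<close> with rows \<open>a j\<close>. Its volume is
  \<open>1 / \<bar>det M\<bar>\<close>, and \<open>M ** transpose M\<close> is the Gram
  matrix.\<close>

lemma halfopen_parallelepiped:
  fixes a u :: "'n \<Rightarrow> real^'d" and J :: "'n set"
  assumes fin: "finite J" and card: "card J = CARD('d)"
    and dual: "\<And>i j. i \<in> J \<Longrightarrow> j \<in> J \<Longrightarrow> a i \<bullet> u j = (if i = j then 1 else 0)"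
  defines "Q \<equiv> {x. \<forall>j\<in>J. -1 \<le> a j \<bullet> x \<and> a j \<bullet> x < 0}"
  shows "measure lborel Q = 1 / sqrt (det_on J (\<lambda>i j. a i \<bullet> a j))" "bounded Q"
proof -
  obtain \<pi> :: "'d idx \<Rightarrow> 'd" where \<pi>: "bij \<pi>"
    using finite_same_card_bij[of "UNIV :: 'd idx set" "UNIV :: 'd set"] by (auto simp: card_idx)
  obtain \<sigma> :: "'d idx \<Rightarrow> 'n" where \<sigma>: "bij_betw \<sigma> UNIV J"
    using finite_same_card_bij[of "UNIV :: 'd idx set" J] fin card by (auto simp: card_idx)
  have \<sigma>J: "\<sigma> k \<in> J" for k
    using \<sigma> by (auto simp: bij_betw_def)
  have \<sigma>eq: "\<sigma> k = \<sigma> l \<longleftrightarrow> k = l" for k l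
    using \<sigma> by (auto simp: bij_betw_def inj_on_def)
  \<comment> \<open>The relabelling preserves inner products and Lebesgue measure, so both volume
    and Gram matrix may be computed after it.\<close>
  define T :: "real^'d \<Rightarrow> real^('d idx)" where "T x = (\<chi> k. x $ \<pi> k)" for x
  define T' :: "real^('d idx) \<Rightarrow> real^'d" where "T' y = (\<chi> i. y $ inv \<pi> i)" for y
  have T'T: "T' (T x) = x" for x
    using \<pi> by (simp add: T_def T'_def vec_eq_iff bij_is_surj surj_f_inv_f)
  have TT: "T x \<bullet> T y = x \<bullet> y" for x y
    unfolding inner_vec_def T_def using sum.reindex_bij_betw[OF \<pi>, of "\<lambda>i. inner (x $ i) (y $ i)"] by simp
  have normT: "norm (T x) = norm x" for x
    by (simp add: norm_eq_sqrt_inner TT)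
  define M :: "real^('d idx)^('d idx)" where "M = (\<chi> k l. T (a (\<sigma> k)) $ l)"
  \<comment> \<open>The columns of \<open>U\<close> are the dual vectors, which makes
    \<open>U\<close> the inverse of \<open>M\<close>.\<close>
  define U :: "real^('d idx)^('d idx)" where "U = (\<chi> l k. T (u (\<sigma> k)) $ l)"
  have MT: "(M *v T x) $ k = a (\<sigma> k) \<bullet> x" for x k
    unfolding TT[symmetric] by (simp add: M_def matrix_vector_mult_def inner_vec_def)
  have MU: "M ** U = mat 1"
  proof -
    have "(M ** U) $ k $ l = T (a (\<sigma> k)) \<bullet> T (u (\<sigma> l))" for k l
      by (simp add: M_def U_def matrix_matrix_mult_def inner_vec_def)
    then show ?thesis
      by (simp add: vec_eq_iff mat_def TT dual \<sigma>J \<sigma>eq)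
  qed
  then have UM: "U ** M = mat 1"
    by (simp add: matrix_left_right_inverse)
  define B :: "(real^('d idx)) set" where "B = {y. \<forall>k. -1 \<le> y $ k \<and> y $ k < 0}"
  define Q' where "Q' = {y. \<forall>k. -1 \<le> (M *v y) $ k \<and> (M *v y) $ k < 0}"
  note B = unit_halfopen_cube[where 'm = "'d idx", folded B_def]
  have Q': "Q' = (*v) U ` B"
  proof
    show "Q' \<subseteq> (*v) U ` B"
    proof
      fix y assume "y \<in> Q'"
      then have "M *v y \<in> B"
        by (simp add: Q'_def B_def)
      moreover have "y = U *v (M *v y)"
        by (simp add: matrix_vector_mul_assoc UM)
      ultimately show "y \<in> (*v) U ` B"
        by blast
    qed
    show "(*v) U ` B \<subseteq> Q'"
      by (auto simp: Q'_def B_def matrix_vector_mul_assoc MU)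
  qed
  have Q: "Q = T -` Q'"
    using \<sigma> by (auto simp: Q_def Q'_def MT bij_betw_def)
  have "bounded Q'"
    unfolding Q' by (intro bounded_linear_image B) simp
  then show "bounded Q"
    unfolding Q bounded_iff using normT by (metis vimageE)
  have Q'_borel: "Q' \<in> sets borel"
  proof -
    have "Q' = (\<Inter>k. {y. -1 \<le> (M *v y) $ k \<and> (M *v y) $ k < 0})"
      by (auto simp: Q'_def)
    moreover have [measurable]: "(\<lambda>y. (M *v y) $ k) \<in> borel_measurable borel" for k
      by (intro borel_measurable_continuous_onI continuous_intros)
    ultimately show ?thesis
      by simp
  qed
  have distr: "distr lborel borel T = lborel"
    unfolding T_def[abs_def] by (rule distr_lborel_reindex[OF \<pi>])
  have T_meas: "T \<in> borel_measurable borel"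
    unfolding T_def[abs_def]
    by (intro borel_measurable_continuous_onI continuous_on_vec_lambda continuous_intros)
  have "measure lborel Q = measure (distr lborel borel T) Q'"
    using T_meas Q'_borel by (subst measure_distr) (auto simp: Q)
  also have "\<dots> = measure lebesgue Q'"
    using Q'_borel by (simp add: distr measure_completion)
  also have "\<dots> = \<bar>det U\<bar>"
    unfolding Q' using measure_linear_image[OF matrix_vector_mul_linear[of U] B(1)] B(2) by simp
  finally have mQ: "measure lborel Q = \<bar>det U\<bar>" .
  have "det M * det U = 1"
    using MU by (metis det_I det_mul)
  then have UM': "\<bar>det U\<bar> = 1 / \<bar>det M\<bar>"
    by (metis abs_mult abs_one mult.commute nonzero_eq_divide_eq mult_eq_0_iff zero_neq_one abs_eq_0)
  have "M ** transpose M = (\<chi> k l. a (\<sigma> k) \<bullet> a (\<sigma> l))"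
  proof -
    have "(M ** transpose M) $ k $ l = T (a (\<sigma> k)) \<bullet> T (a (\<sigma> l))" for k l
      by (simp add: M_def transpose_def matrix_matrix_mult_def inner_vec_def)
    then show ?thesis
      by (simp add: vec_eq_iff TT)
  qed
  then have "det_on J (\<lambda>i j. a i \<bullet> a j) = (det M)\<^sup>2"
    unfolding det_on_eq_det[OF \<sigma>] by (metis det_mul det_transpose power2_eq_square)
  then show "measure lborel Q = 1 / sqrt (det_on J (\<lambda>i j. a i \<bullet> a j))"
    by (simp add: mQ UM')
qed

section \<open>The Gaussian integral of the face complex\<close>

definition face_term :: "('n \<Rightarrow> 'v::euclidean_space) \<Rightarrow> 'n set \<Rightarrow> real^'n \<Rightarrow> 'v \<Rightarrow> real" where
  "face_term a F b x = (\<Prod>j\<in>F. heaviside (a j \<bullet> x + b $ j) - 1)"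

definition gauss_sum :: "real \<Rightarrow> ('n \<Rightarrow> 'v::euclidean_space) \<Rightarrow> 'n set set \<Rightarrow> real^'n \<Rightarrow> real" where
  "gauss_sum c a K b = (\<integral>x. c * exp (- (x \<bullet> x) / 2) * (\<Sum>F\<in>K. face_term a F b x) \<partial>lborel)"

lemma gauss_poly_gaussian: "gauss_poly (\<lambda>x. c * exp (- (x \<bullet> x) / 2))"
  unfolding gauss_poly_def by (intro exI[of _ "\<lambda>_. c"]) auto

lemma face_term_measurable: "face_term a F b \<in> borel_measurable borel"
proof -
  have [measurable]: "heaviside \<in> borel_measurable borel"
    unfolding heaviside_def[abs_def] by measurable
  show ?thesis
    unfolding face_term_def[abs_def] by measurable
qed

lemma abs_face_term_le: "\<bar>face_term a F b x\<bar> \<le> 1"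
  unfolding face_term_def abs_prod by (rule prod_le_1) (auto simp: heaviside_def)

lemma face_term_eq:
  fixes a :: "'n::finite \<Rightarrow> 'v::euclidean_space"
  shows "face_term a F b x = (if F \<subseteq> {j. a j \<bullet> x + b $ j < 0} then (-1) ^ card F else 0)"
proof (cases "F \<subseteq> {j. a j \<bullet> x + b $ j < 0}")
  case True
  then have "face_term a F b x = (\<Prod>j\<in>F. -1)"
    unfolding face_term_def by (intro prod.cong) (auto simp: heaviside_def)
  then show ?thesis
    using True by simp
next
  case False
  then obtain j where "j \<in> F" "\<not> a j \<bullet> x + b $ j < 0"
    by blast
  then have "face_term a F b x = 0"
    unfolding face_term_def by (intro prod_zero) (auto simp: heaviside_def intro!: bexI[of _ j])
  then show ?thesis
    using False by simp
qed

text \<open>Identifies the factor multiplying the Gaussian with the alternating sum that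
  \<open>alternating_sum_eq_0\<close> shows to vanish far from the origin.\<close>

lemma sum_face_term_eq:
  fixes a :: "'n::finite \<Rightarrow> 'v::euclidean_space"
  shows "(\<Sum>F\<in>K. face_term a F b x) = (\<Sum>F | F \<in> K \<and> F \<subseteq> {j. a j \<bullet> x + b $ j < 0}. (-1) ^ card F)"
  unfolding face_term_eq by (subst sum.inter_filter[symmetric]) auto

lemma integrable_gaussian_face_term:
  "integrable lborel (\<lambda>x. c * exp (- (x \<bullet> x) / 2) * face_term a F b x)"
  using integrable_conv_against[OF face_term_measurable[of a F b] abs_face_term_le gauss_poly_gaussian, of c 0]
  by (simp add: mult_ac)

text \<open>A vector \<open>w\<close> solving the equations \<open>a j \<bullet> w = b $ j\<close>
  shifts the dependence on \<open>b\<close> from the Heaviside factors to the Gaussian, by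
  translation invariance.\<close>

lemma integral_gaussian_face_term:
  fixes a :: "'n::finite \<Rightarrow> 'v::euclidean_space"
  assumes w: "\<And>j. j \<in> F \<Longrightarrow> a j \<bullet> w = b $ j"
  shows "(\<integral>x. c * exp (- (x \<bullet> x) / 2) * face_term a F b x \<partial>lborel) =
    conv_against (face_term a F 0) (\<lambda>x. c * exp (- (x \<bullet> x) / 2)) w"
proof -
  note [measurable] = face_term_measurable
  have shift: "face_term a F 0 (w + x) = face_term a F b x" for x
    unfolding face_term_def using w by (intro prod.cong) (auto simp: inner_add_right add_ac)
  have "conv_against (face_term a F 0) (\<lambda>x. c * exp (- (x \<bullet> x) / 2)) w =
      (\<integral>x. face_term a F 0 x * (c * exp (- ((x - w) \<bullet> (x - w)) / 2)) \<partial>distr lborel borel ((+) w))"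
    by (simp add: conv_against_def lborel_distr_plus)
  also have "\<dots> = (\<integral>x. face_term a F b x * (c * exp (- (x \<bullet> x) / 2)) \<partial>lborel)"
    by (subst integral_distr) (auto simp: shift)
  finally show ?thesis
    by (simp add: mult_ac)
qed

lemma integral_lborel_scale:
  fixes f :: "'v::euclidean_space \<Rightarrow> real"
  assumes [measurable]: "f \<in> borel_measurable borel" and h: "h > 0"
  shows "(\<integral>x. f x \<partial>lborel) = h ^ DIM('v) * (\<integral>x. f (h *\<^sub>R x) \<partial>lborel)"
proof -
  have "(\<integral>x. f x \<partial>lborel) =
      (\<integral>x. f x \<partial>density (distr lborel borel (\<lambda>x. 0 + h *\<^sub>R x)) (\<lambda>_. ennreal (\<bar>h\<bar> ^ DIM('v))))"
    using h by (subst lborel_affine[of h 0]) (auto simp: ennreal_power)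
  also have "\<dots> = (\<integral>x. h ^ DIM('v) * f x \<partial>distr lborel borel (\<lambda>x. 0 + h *\<^sub>R x))"
    using h by (subst integral_density) auto
  also have "\<dots> = (\<integral>x. h ^ DIM('v) * f (h *\<^sub>R x) \<partial>lborel)"
    by (subst integral_distr) auto
  finally show ?thesis
    by simp
qed

text \<open>On a bounded set the rescaled Gaussian converges to its value \<open>c\<close> at the
  origin, dominated by a multiple of the indicator.\<close>

lemma scaled_gaussian_integral_tendsto:
  fixes Q :: "'v::euclidean_space set"
  assumes Q: "Q \<in> sets borel" "bounded Q" and h: "h \<longlonglongrightarrow> 0"
  shows "(\<lambda>i. \<integral>x. c * exp (- ((h i *\<^sub>R x) \<bullet> (h i *\<^sub>R x)) / 2) * indicator Q x \<partial>lborel)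
    \<longlonglongrightarrow> c * measure lborel Q"
proof -
  note [measurable] = Q(1)
  have fin: "emeasure lborel Q < \<infinity>"
    using Q(2) by (rule emeasure_bounded_finite)
  have "(\<lambda>i. \<integral>x. c * exp (- ((h i *\<^sub>R x) \<bullet> (h i *\<^sub>R x)) / 2) * indicator Q x \<partial>lborel)
      \<longlonglongrightarrow> (\<integral>x. c * indicator Q x \<partial>lborel)"
  proof (rule integral_dominated_convergence)
    show "integrable lborel (\<lambda>x. \<bar>c\<bar> * indicator Q x)"
      using fin by (intro integrable_mult_right integrable_real_indicator) auto
    show "AE x in lborel. (\<lambda>i. c * exp (- ((h i *\<^sub>R x) \<bullet> (h i *\<^sub>R x)) / 2) * indicator Q x)
        \<longlonglongrightarrow> c * indicator Q x"
    proof (intro AE_I2)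
      fix x :: 'v
      have "(\<lambda>i. c * exp (- ((h i *\<^sub>R x) \<bullet> (h i *\<^sub>R x)) / 2) * indicator Q x)
          \<longlonglongrightarrow> c * exp (- ((0 *\<^sub>R x) \<bullet> (0 *\<^sub>R x)) / 2) * indicator Q x"
        by (intro tendsto_intros h) auto
      then show "(\<lambda>i. c * exp (- ((h i *\<^sub>R x) \<bullet> (h i *\<^sub>R x)) / 2) * indicator Q x)
          \<longlonglongrightarrow> c * indicator Q x"
        by simp
    qed
    show "AE x in lborel. norm (c * exp (- ((h i *\<^sub>R x) \<bullet> (h i *\<^sub>R x)) / 2) * indicator Q x)
        \<le> \<bar>c\<bar> * indicator Q x" for i
      by (intro AE_I2) (auto simp: abs_mult mult_left_le split: split_indicator
          simp del: inner_scaleR_left inner_scaleR_right)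
  qed measurable
  also have "(\<integral>x. c * indicator Q x \<partial>lborel) = c * measure lborel Q"
    by simp
  finally show ?thesis .
qed

section \<open>Smoothness, growth and derivatives at 0 of the Gaussian sum\<close>

context simple_polytope
begin

abbreviation "K \<equiv> face_complex a \<beta>"

lemma gauss_sum_eq:
  "gauss_sum c a K b = (\<Sum>F\<in>K. \<integral>x. c * exp (- (x \<bullet> x) / 2) * face_term a F b x \<partial>lborel)"
  unfolding gauss_sum_def sum_distrib_left
  by (intro Bochner_Integration.integral_sum integrable_gaussian_face_term)

text \<open>The dual vectors at a point of the face give a solution depending linearly on
  \<open>b\<close>, which keeps the shifted Gaussian differentiable in \<open>b\<close>.\<close>

lemma exists_linear_solution:
  assumes "F \<in> K"
  obtains L :: "real^'n \<Rightarrow> 'v" where "linear L" "\<And>j b. j \<in> F \<Longrightarrow> a j \<bullet> L b = b $ j"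
proof -
  obtain y where y: "y \<in> P" "F \<subseteq> act y"
    using assms by (auto simp: face_complex_def)
  define L :: "real^'n \<Rightarrow> 'v" where "L b = (\<Sum>j\<in>F. (b $ j) *\<^sub>R u (act y) j)" for b
  show thesis
  proof (rule that)
    show "linear L"
      unfolding L_def
      by (rule linearI) (auto simp: scaleR_left_distrib sum.distrib scaleR_sum_right)
    fix i b assume i: "i \<in> F"
    have "a i \<bullet> L b = (\<Sum>j\<in>F. b $ j * (a i \<bullet> u (act y) j))"
      by (simp add: L_def inner_sum_right)
    also have "\<dots> = (\<Sum>j\<in>F. if j = i then b $ j else 0)"
      using dual[OF y(1)] subsetD[OF y(2)] i by (intro sum.cong) simp_all
    finally show "a i \<bullet> L b = b $ i"
      using i by simp
  qed
qed

lemma card_face_le: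
  assumes "F \<in> K"
  shows "card F \<le> DIM('v)"
proof -
  obtain y where y: "y \<in> P" "F \<subseteq> act y"
    using assms by (auto simp: face_complex_def)
  have d: "a i \<bullet> u (act y) j = (if i = j then 1 else 0)" if "i \<in> F" "j \<in> F" for i j
    using dual[OF y(1)] subsetD[OF y(2)] that by simp
  have inj: "inj_on a F"
    by (rule inj_onI) (metis d zero_neq_one)
  have "independent (a ` F)"
  proof (rule independent_if_scalars_zero)
    fix f x assume s: "(\<Sum>x\<in>a ` F. f x *\<^sub>R x) = 0" and x: "x \<in> a ` F"
    then obtain j where j: "j \<in> F" "x = a j"
      by auto
    have "0 = (\<Sum>i\<in>F. f (a i) *\<^sub>R a i) \<bullet> u (act y) j"
      using s by (simp add: sum.reindex[OF inj])
    also have "\<dots> = (\<Sum>i\<in>F. f (a i) * (a i \<bullet> u (act y) j))"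
      by (simp add: inner_sum_left)
    also have "\<dots> = (\<Sum>i\<in>F. if i = j then f (a i) else 0)"
      using d j by (intro sum.cong) simp_all
    finally show "f x = 0"
      using j by simp
  qed simp
  then have "card (a ` F) \<le> DIM('v)"
    using independent_bound by blast
  then show ?thesis
    by (simp add: card_image[OF inj])
qed

text \<open>Each summand is a Gaussian convolution composed with a linear map of its own, chosen for
  the face \<open>F\<close>; the finite sum inherits derivatives and continuity.\<close>

lemma gauss_sum_smooth:
  obtains \<Psi> where "iter_partial js (gauss_sum c a K) \<Psi>" "isCont \<Psi> 0"
proof -
  have "\<exists>\<Psi>. iter_partial js (\<lambda>b. \<integral>x. c * exp (- (x \<bullet> x) / 2) * face_term a F b x \<partial>lborel) \<Psi> \<and> isCont \<Psi> 0"
    if F: "F \<in> K" for F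
  proof -
    obtain L :: "real^'n \<Rightarrow> 'v" where L: "linear L" "\<And>j b. j \<in> F \<Longrightarrow> a j \<bullet> L b = b $ j"
      using exists_linear_solution[OF F] by blast
    let ?g = "\<lambda>x::'v. c * exp (- (x \<bullet> x) / 2)"
    have eq: "(\<lambda>b. \<integral>x. ?g x * face_term a F b x \<partial>lborel) = (\<lambda>b. conv_against (face_term a F 0) ?g (L b))"
      using integral_gaussian_face_term[of F a, OF L(2)] by (intro ext) simp
    show ?thesis
      unfolding eq
      using conv_against_iter_partial[OF face_term_measurable[of a F 0] abs_face_term_le L(1) gauss_poly_gaussian, of js c]
        conv_against_isCont[OF face_term_measurable[of a F 0] abs_face_term_le L(1)]
      by blast
  qed
  then have "\<forall>F\<in>K. \<exists>\<Psi>. iter_partial js (\<lambda>b. \<integral>x. c * exp (- (x \<bullet> x) / 2) * face_term a F b x \<partial>lborel) \<Psi> \<and> isCont \<Psi> 0"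
    by blast
  from bchoice[OF this] obtain \<Psi> where \<Psi>: "\<forall>F\<in>K.
      iter_partial js (\<lambda>b. \<integral>x. c * exp (- (x \<bullet> x) / 2) * face_term a F b x \<partial>lborel) (\<Psi> F) \<and> isCont (\<Psi> F) 0"
    by (rule exE)
  show thesis
  proof (rule that)
    show "iter_partial js (gauss_sum c a K) (\<lambda>b. \<Sum>F\<in>K. \<Psi> F b)"
      unfolding gauss_sum_eq[abs_def] using \<Psi> by (intro iter_partial_sum) auto
    show "isCont (\<lambda>b. \<Sum>F\<in>K. \<Psi> F b) 0"
      using \<Psi> by (intro continuous_intros) auto
  qed
qed

text \<open>The integrand is bounded and vanishes outside a ball of radius
  \<open>C * norm b\<close>, whose volume supplies the power of \<open>norm b\<close>.\<close>

lemma gauss_sum_bound: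
  obtains M where "M \<ge> 0" "\<And>b. \<bar>gauss_sum c a K b\<bar> \<le> M * norm b ^ DIM('v)"
proof -
  obtain C where C: "C > 0" and zero: "\<And>x b. norm x > C * norm (b :: real^'n) \<Longrightarrow>
      (\<Sum>F | F \<in> K \<and> F \<subseteq> {j. a j \<bullet> x + b $ j < 0}. (-1) ^ card F :: real) = 0"
    using alternating_sum_eq_0 by blast
  define M where "M = \<bar>c\<bar> * card K * (unit_ball_vol (DIM('v)) * C ^ DIM('v))"
  show thesis
  proof (rule that[of M])
    show "M \<ge> 0"
      using C by (simp add: M_def unit_ball_vol_nonneg)
    fix b :: "real^'n"
    let ?S = "\<lambda>x. \<Sum>F\<in>K. face_term a F b x"
    let ?B = "cball (0::'v) (C * norm b)"
    have S_le: "\<bar>?S x\<bar> \<le> real (card K) * indicator ?B x" for x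
    proof (cases "x \<in> ?B")
      case True
      have "\<bar>?S x\<bar> \<le> (\<Sum>F\<in>K. \<bar>face_term a F b x\<bar>)"
        by (rule sum_abs)
      also have "\<dots> \<le> (\<Sum>F\<in>K. 1)"
        by (intro sum_mono abs_face_term_le)
      finally show ?thesis
        using True by simp
    next
      case False
      then have "?S x = 0"
        unfolding sum_face_term_eq by (intro zero) simp
      then show ?thesis
        by simp
    qed
    have "norm (gauss_sum c a K b) \<le> (\<integral>x. \<bar>c\<bar> * real (card K) * indicator ?B x \<partial>lborel)"
      unfolding gauss_sum_def
    proof (rule Bochner_Integration.integral_norm_bound_integral)
      show "integrable lborel (\<lambda>x. c * exp (- (x \<bullet> x) / 2) * ?S x)"
        unfolding sum_distrib_left by (intro Bochner_Integration.integrable_sum integrable_gaussian_face_term)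
      show "integrable lborel (\<lambda>x. \<bar>c\<bar> * real (card K) * indicator ?B x)"
        by (intro integrable_mult_right integrable_real_indicator emeasure_lborel_cball_finite) auto
      fix x :: 'v
      have "\<bar>c * exp (- (x \<bullet> x) / 2)\<bar> * \<bar>?S x\<bar> \<le> \<bar>c\<bar> * (real (card K) * indicator ?B x)"
        by (intro mult_mono S_le) (auto simp: abs_mult mult_left_le)
      then show "norm (c * exp (- (x \<bullet> x) / 2) * ?S x) \<le> \<bar>c\<bar> * real (card K) * indicator ?B x"
        by (simp add: abs_mult mult.assoc)
    qed
    also have "\<dots> = \<bar>c\<bar> * real (card K) * measure lborel ?B"
      by simp
    also have "\<dots> = M * norm b ^ DIM('v)"
      using C by (simp add: M_def content_cball power_mult_distrib mult_ac)
    finally show "\<bar>gauss_sum c a K b\<bar> \<le> M * norm b ^ DIM('v)"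
      by simp
  qed
qed

text \<open>All points entering the difference at 0 lie within \<open>length js * h\<close> of 0, so
  the quotient is bounded by a constant times \<open>h ^ (DIM('v) - length js)\<close>, a positive
  power of \<open>h\<close>.\<close>

lemma mixed_partial_low:
  assumes ip: "iter_partial js (gauss_sum c a K) \<Psi>" "isCont \<Psi> 0" and len: "length js < DIM('v)"
  shows "\<Psi> 0 = 0"
proof -
  obtain M where M: "M \<ge> 0" "\<And>b. \<bar>gauss_sum c a K b\<bar> \<le> M * norm b ^ DIM('v)"
    by (rule gauss_sum_bound) blast
  let ?n = "length js" and ?d = "DIM('v)"
  let ?D = "\<lambda>h. mixed_diff js h (gauss_sum c a K) 0"
  have le: "norm (?D h / h ^ ?n) \<le> 2 ^ ?n * M * real ?n ^ ?d * h ^ (?d - ?n)" if h: "h > 0" for h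
  proof -
    have "\<bar>gauss_sum c a K b\<bar> \<le> M * (real ?n * h) ^ ?d" if "norm (b - 0) \<le> real ?n * h" for b :: "real^'n"
      by (rule order_trans[OF M(2)]) (use that M(1) in \<open>auto intro!: mult_left_mono power_mono\<close>)
    then have "\<bar>?D h\<bar> \<le> 2 ^ ?n * (M * (real ?n * h) ^ ?d)"
      using h by (intro mixed_diff_bound) auto
    then have "\<bar>?D h\<bar> / h ^ ?n \<le> 2 ^ ?n * (M * (real ?n * h) ^ ?d) / h ^ ?n"
      using h by (intro divide_right_mono) auto
    also have "\<dots> = 2 ^ ?n * M * real ?n ^ ?d * h ^ (?d - ?n)"
      using h len by (simp add: power_mult_distrib power_diff)
    finally show ?thesis
      using h by (simp add: abs_mult)
  qed
  have "((\<lambda>h. ?D h / h ^ ?n) \<longlongrightarrow> 0) (at_right 0)"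
  proof (rule Lim_null_comparison)
    show "\<forall>\<^sub>F h in at_right 0. norm (?D h / h ^ ?n) \<le> 2 ^ ?n * M * real ?n ^ ?d * h ^ (?d - ?n)"
      using eventually_at_right_less[of "0::real"] by eventually_elim (rule le)
    have "((\<lambda>h. 2 ^ ?n * M * real ?n ^ ?d * h ^ (?d - ?n)) \<longlongrightarrow> 2 ^ ?n * M * real ?n ^ ?d * 0 ^ (?d - ?n)) (at_right (0::real))"
      by (intro tendsto_intros)
    moreover have "2 ^ ?n * M * real ?n ^ ?d * 0 ^ (?d - ?n) = 0"
      using len by simp
    ultimately show "((\<lambda>h. 2 ^ ?n * M * real ?n ^ ?d * h ^ (?d - ?n)) \<longlongrightarrow> 0) (at_right (0::real))"
      by (simp only:)
  qed
  then show ?thesis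
    using mixed_diff_quotient_tendsto[OF ip] by (intro tendsto_unique[of "at_right (0::real)"]) auto
qed

text \<open>A face has at most \<open>DIM('v)\<close> indices, so any face other than
  \<open>set js\<close> misses some \<open>j\<close> in \<open>js\<close>, and the difference in
  \<open>b $ j\<close> annihilates its term.\<close>

lemma mixed_diff_gauss_sum_top:
  assumes js: "distinct js" "set js \<in> K" "length js = DIM('v)"
  shows "mixed_diff js h (gauss_sum c a K) 0 =
    (\<integral>x. c * exp (- (x \<bullet> x) / 2) *
      (\<Prod>j\<in>set js. heaviside (a j \<bullet> x + h) - heaviside (a j \<bullet> x)) \<partial>lborel)"
proof -
  have other: "mixed_diff js h (\<lambda>b. face_term a F b x) 0 = 0" if F: "F \<in> K" "F \<noteq> set js" for F x
  proof -
    have "\<not> set js \<subseteq> F"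
    proof
      assume sub: "set js \<subseteq> F"
      have "card F \<le> card (set js)"
        using card_face_le[OF F(1)] js by (simp add: distinct_card)
      then show False
        using card_seteq[OF _ sub] F(2) by auto
    qed
    then obtain j where j: "j \<in> set js" "j \<notin> F"
      by blast
    show ?thesis
    proof (rule mixed_diff_independent[OF j(1)])
      show "face_term a F (b + t *\<^sub>R axis j 1) x = face_term a F b x" for b t
        unfolding face_term_def using j(2) by (intro prod.cong) (auto simp: axis_def)
    qed
  qed
  have top: "mixed_diff js h (\<lambda>b. face_term a (set js) b x) 0 =
      (\<Prod>j\<in>set js. heaviside (a j \<bullet> x + h) - heaviside (a j \<bullet> x))" for x
    using mixed_diff_prod[OF js(1), of "\<lambda>_. 1" h "\<lambda>j t. heaviside (a j \<bullet> x + t) - 1" 0]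
    by (simp add: face_term_def[abs_def])
  have integrand: "mixed_diff js h (\<lambda>b. c * exp (- (x \<bullet> x) / 2) * (\<Sum>F\<in>K. face_term a F b x)) 0 =
      c * exp (- (x \<bullet> x) / 2) * (\<Prod>j\<in>set js. heaviside (a j \<bullet> x + h) - heaviside (a j \<bullet> x))" for x
  proof -
    have "(\<Sum>F\<in>K. mixed_diff js h (\<lambda>b. face_term a F b x) 0) =
        (\<Sum>F\<in>{set js}. mixed_diff js h (\<lambda>b. face_term a F b x) 0)"
      using js(2) other by (intro sum.mono_neutral_right) auto
    then show ?thesis
      by (simp add: mixed_diff_cmult mixed_diff_sum top)
  qed
  have "mixed_diff js h (gauss_sum c a K) 0 =
      (\<integral>x. mixed_diff js h (\<lambda>b. c * exp (- (x \<bullet> x) / 2) * (\<Sum>F\<in>K. face_term a F b x)) 0 \<partial>lborel)"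
    unfolding gauss_sum_def
    by (intro mixed_diff_integral)
      (unfold sum_distrib_left, intro Bochner_Integration.integrable_sum integrable_gaussian_face_term)
  then show ?thesis
    by (simp only: integrand)
qed

text \<open>Substituting \<open>h *\<^sub>R x\<close> for \<open>x\<close> produces the factor
  \<open>h ^ DIM('v)\<close>, which cancels the denominator. The domain becomes the fixed set
  \<open>Q\<close> while the Gaussian flattens to \<open>c\<close>.\<close>

lemma mixed_partial_top:
  assumes ip: "iter_partial js (gauss_sum c a K) \<Psi>" "isCont \<Psi> 0"
    and js: "distinct js" "set js \<in> K" "length js = DIM('v)"
  defines "Q \<equiv> {x. \<forall>j\<in>set js. -1 \<le> a j \<bullet> x \<and> a j \<bullet> x < 0}"
  assumes Q: "bounded Q"
  shows "\<Psi> 0 = c * measure lborel Q"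
proof -
  let ?D = "\<lambda>h. mixed_diff js h (gauss_sum c a K) 0"
  have Q_borel: "Q \<in> sets borel"
    unfolding Q_def by measurable
  have eq: "?D h / h ^ length js =
      (\<integral>x. c * exp (- ((h *\<^sub>R x) \<bullet> (h *\<^sub>R x)) / 2) * indicator Q x \<partial>lborel)" if h: "h > 0" for h
  proof -
    have [measurable]: "heaviside \<in> borel_measurable borel"
      unfolding heaviside_def[abs_def] by measurable
    \<comment> \<open>The interval is closed at -1 and open at 0 because \<open>heaviside 0\<close>
      is 1.\<close>
    have "heaviside (h * t + h) - heaviside (h * t) = indicator {-1..<0} t" for t
    proof -
      have "h * t + h = h * (t + 1)"
        by (simp add: algebra_simps)
      then show ?thesis
        using h by (auto simp: heaviside_def zero_le_mult_iff split: split_indicator)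
    qed
    then have ind: "(\<Prod>j\<in>set js. heaviside (a j \<bullet> (h *\<^sub>R x) + h) - heaviside (a j \<bullet> (h *\<^sub>R x))) =
        (indicator Q x :: real)" for x
      by (auto simp: Q_def indicator_def prod_zero_iff)
    have "?D h = h ^ DIM('v) * (\<integral>x. c * exp (- ((h *\<^sub>R x) \<bullet> (h *\<^sub>R x)) / 2) *
        (\<Prod>j\<in>set js. heaviside (a j \<bullet> (h *\<^sub>R x) + h) - heaviside (a j \<bullet> (h *\<^sub>R x))) \<partial>lborel)"
      unfolding mixed_diff_gauss_sum_top[OF js] by (rule integral_lborel_scale[OF _ h]) measurable
    then show ?thesis
      using h js by (simp only: ind) simp
  qed
  \<comment> \<open>The one-sided limit is sampled along a sequence so that dominated convergence
    applies.\<close>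
  define h :: "nat \<Rightarrow> real" where "h i = inverse (real (Suc i))" for i
  have h0: "h \<longlonglongrightarrow> 0"
    unfolding h_def by (rule LIMSEQ_inverse_real_of_nat)
  have hpos: "h i > 0" for i
    by (simp add: h_def)
  have "filterlim h (at_right 0) sequentially"
    using h0 hpos by (intro tendsto_imp_filterlim_at_right) auto
  then have "(\<lambda>i. ?D (h i) / h i ^ length js) \<longlonglongrightarrow> \<Psi> 0"
    by (rule filterlim_compose[OF mixed_diff_quotient_tendsto[OF ip]])
  moreover have "(\<lambda>i. ?D (h i) / h i ^ length js) \<longlonglongrightarrow> c * measure lborel Q"
    unfolding eq[OF hpos] by (rule scaled_gaussian_integral_tendsto[OF Q_borel Q h0])
  ultimately show ?thesis
    by (rule LIMSEQ_unique)
qed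

end

section \<open>From general position to a simple polytope, and the evaluation\<close>

lemma polyhedron_indep_active:
  fixes a0 :: "real^'n^'d"
  assumes gp: "general_position a0 b0" and y: "y \<in> polyhedron_of a0 b0"
  shows "indep_family {j. aff_form a0 b0 j y = 0} (\<lambda>j. column j a0)"
  unfolding indep_family_def
proof (intro allI impI)
  let ?I = "{j. aff_form a0 b0 j y = 0}"
  fix c assume c: "(\<Sum>j\<in>?I. c j *\<^sub>R column j a0) = 0"
  have comb: "(\<Sum>j\<in>?I. c j * (\<Sum>i\<in>UNIV. a0 $ i $ j * x $ i)) = 0" for x
  proof -
    have "(\<Sum>j\<in>?I. c j * (\<Sum>i\<in>UNIV. a0 $ i $ j * x $ i)) = (\<Sum>j\<in>?I. c j *\<^sub>R column j a0) \<bullet> x"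
      by (simp add: inner_sum_left) (simp add: inner_vec_def column_def)
    then show ?thesis
      using c by simp
  qed
  \<comment> \<open>For a constraint active at \<open>y\<close>, the offset is minus the linear part
    at \<open>y\<close>. Hence a vanishing combination of normals is also one of the homogeneous
    forms.\<close>
  have form: "hom_form a0 b0 (Some j) (x0, x) = (\<Sum>i\<in>UNIV. a0 $ i $ j * x $ i) -
      x0 * (\<Sum>i\<in>UNIV. a0 $ i $ j * y $ i)" if "j \<in> ?I" for j x0 x
    using that by (simp add: aff_form_def eq_neg_iff_add_eq_0[symmetric] add_eq_0_iff)
  \<comment> \<open>The first coordinate 1 makes this point nonzero, so it witnesses the premise of
    general position for the constraints active at \<open>y\<close>.\<close>
  have p1: "(1, y) \<in> hom_polyhedron a0 b0"
  proof -
    have "0 \<le> hom_form a0 b0 j (1, y)" for j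
      using y by (cases j) (auto simp: polyhedron_of_def half_space_def aff_form_def)
    then show ?thesis
      by (simp add: hom_polyhedron_def)
  qed
  have p2: "hom_form a0 b0 j (1, y) = 0" if "j \<in> Some ` ?I" for j
    using that by (auto simp: aff_form_def)
  have indep: "independent_forms (Some ` ?I) (hom_form a0 b0)"
    using gp p1 p2 unfolding general_position_def by (metis (no_types, lifting) Pair_inject one_neq_zero zero_prod_def)
  have zero: "(\<Sum>j\<in>Some ` ?I. c (the j) * hom_form a0 b0 j p) = 0" for p
  proof -
    obtain x0 x where p: "p = (x0, x)"
      by (cases p)
    have "(\<Sum>j\<in>Some ` ?I. c (the j) * hom_form a0 b0 j p) = (\<Sum>j\<in>?I. c j * hom_form a0 b0 (Some j) (x0, x))"
      by (simp add: sum.reindex p del: hom_form.simps)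
    also have "\<dots> = (\<Sum>j\<in>?I. c j * (\<Sum>i\<in>UNIV. a0 $ i $ j * x $ i) - x0 * (c j * (\<Sum>i\<in>UNIV. a0 $ i $ j * y $ i)))"
      by (intro sum.cong refl) (simp only: form, simp add: algebra_simps)
    also have "\<dots> = 0"
      by (simp add: sum_subtractf comb flip: sum_distrib_left)
    finally show ?thesis .
  qed
  have "\<forall>j\<in>Some ` ?I. c (the j) = 0"
    using indep[unfolded independent_forms_def, THEN spec, of "\<lambda>j. c (the j)"] zero by (rule mp[OF _ allI])
  then show "\<forall>j\<in>?I. c j = 0"
    by auto
qed

lemma aff_form_eq_inner: "aff_form a0 b j x = column j a0 \<bullet> x + b $ j"
  by (simp add: aff_form_def inner_vec_def column_def)

lemma phi_eq_gauss_sum: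
  "phi K a0 = gauss_sum (1 / (2 * pi) powr (real CARD('d) / 2)) (\<lambda>j. column j (a0 :: real^'n^'d)) K"
proof
  fix b
  have "(\<Sum>i\<in>UNIV. (x $ i)\<^sup>2) = x \<bullet> x" for x :: "real^'d"
    by (simp add: inner_vec_def power2_eq_square)
  then show "phi K a0 b = gauss_sum (1 / (2 * pi) powr (real CARD('d) / 2)) (\<lambda>j. column j a0) K b"
    by (simp add: phi_def gauss_sum_def face_term_def aff_form_eq_inner)
qed

theorem proposition9:
  fixes a0 :: "real^'n^'d" and b0 :: "real^'n" and J :: "'n set"
  assumes "bounding_half_spaces a0 b0"
    and "general_position a0 b0"
    and "bounded (polyhedron_of a0 b0)"
    and "J \<in> assoc_complex a0 b0"
  shows "has_mixed_partial J (phi (assoc_complex a0 b0) a0) 0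
           (if card J = CARD('d)
            then 1 / ((2 * pi) powr (real CARD('d) / 2) * sqrt (det_on J (alpha a0)))
            else 0)"
proof -
  define a where "a j = column j a0" for j
  define \<beta> where "\<beta> j = b0 $ j" for j
  have P: "polyhedron_of a0 b0 = poly_set a \<beta>"
    by (auto simp: polyhedron_of_def half_space_def aff_form_eq_inner poly_set_def a_def \<beta>_def)
  have act: "{j. aff_form a0 b0 j y = 0} = active a \<beta> y" for y
    by (simp add: active_def aff_form_eq_inner a_def \<beta>_def)
  \<comment> \<open>This point puts the empty face into \<open>face_complex\<close>; in
    \<open>assoc_complex\<close> it is present because the empty intersection is the whole
    space.\<close>
  obtain y0 where y0: "y0 \<in> poly_set a \<beta>"
    using assms(1) interior_subset unfolding bounding_half_spaces_def P by blast
  have K: "assoc_complex a0 b0 = face_complex a \<beta>"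
  proof -
    have "(\<Inter>j\<in>F. facet a0 b0 j) \<noteq> {} \<longleftrightarrow> (\<exists>y\<in>poly_set a \<beta>. F \<subseteq> active a \<beta> y)" for F
    proof (cases "F = {}")
      case True
      then show ?thesis
        using y0 by auto
    next
      case False
      then have "(\<Inter>j\<in>F. facet a0 b0 j) = {y\<in>poly_set a \<beta>. F \<subseteq> active a \<beta> y}"
        unfolding facet_def P act[symmetric] by auto
      then show ?thesis
        by auto
    qed
    then show ?thesis
      by (simp add: assoc_complex_def face_complex_def)
  qed
  have ind: "indep_family (active a \<beta> y) a" if "y \<in> poly_set a \<beta>" for y
    using polyhedron_indep_active[OF assms(2), of y] that unfolding P act by (simp add: a_def[abs_def])
  \<comment> \<open>For dependent index sets the choice is arbitrary; the locale only evaluates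
    \<open>u\<close> at active sets, which \<open>ind\<close> shows to be independent.\<close>
  have "\<forall>I. \<exists>u. indep_family I a \<longrightarrow> (\<forall>i\<in>I. \<forall>j\<in>I. a i \<bullet> u j = (if i = j then 1 else 0))"
  proof
    fix I
    show "\<exists>u. indep_family I a \<longrightarrow> (\<forall>i\<in>I. \<forall>j\<in>I. a i \<bullet> u j = (if i = j then 1 else 0))"
      using exists_dual_family[OF finite, of I a] by (cases "indep_family I a") simp_all
  qed
  from choice[OF this] obtain u where
    u: "\<forall>I. indep_family I a \<longrightarrow> (\<forall>i\<in>I. \<forall>j\<in>I. a i \<bullet> u I j = (if i = j then 1 else 0))"
    by (rule exE)
  interpret simple_polytope a \<beta> u
  proof
    show "bounded (poly_set a \<beta>)"
      using assms(3) by (simp add: P)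
    show "a i \<bullet> u (active a \<beta> y) j = (if i = j then 1 else 0)"
      if "y \<in> poly_set a \<beta>" "i \<in> active a \<beta> y" "j \<in> active a \<beta> y" for y i j
      using u[rule_format, OF ind that(2,3)] that(1) by simp
  qed
  define c where "c = 1 / (2 * pi) powr (real CARD('d) / 2)"
  have phi: "phi (assoc_complex a0 b0) a0 = gauss_sum c a (face_complex a \<beta>)"
    unfolding K phi_eq_gauss_sum c_def a_def ..
  have J: "J \<in> face_complex a \<beta>"
    using assms(4) by (simp add: K)
  show ?thesis
    unfolding has_mixed_partial_def
  proof (intro allI impI)
    \<comment> \<open>The value found for \<open>\<Psi> 0\<close> depends only on the set
      \<open>J\<close>, so every order of differentiation gives the same result.\<close>
    fix js assume js: "distinct js \<and> set js = J"
    then have len: "length js = card J"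
      using distinct_card[of js] by simp
    obtain \<Psi> where \<Psi>: "iter_partial js (gauss_sum c a (face_complex a \<beta>)) \<Psi>" "isCont \<Psi> 0"
      by (rule gauss_sum_smooth)
    have "\<Psi> 0 = (if card J = CARD('d)
        then 1 / ((2 * pi) powr (real CARD('d) / 2) * sqrt (det_on J (alpha a0))) else 0)"
    proof (cases "card J = CARD('d)")
      case False
      \<comment> \<open>Faces never have more than \<open>CARD('d)\<close> indices, so a cardinality
        different from the dimension is smaller.\<close>
      then have "length js < DIM(real^'d)"
        using card_face_le[OF J] len by simp
      then show ?thesis
        using mixed_partial_low[OF \<Psi>] False by simp
    next
      case True
      obtain y where y: "y \<in> poly_set a \<beta>" "J \<subseteq> active a \<beta> y"
        using J by (auto simp: face_complex_def)
      let ?Q = "{x. \<forall>j\<in>J. -1 \<le> a j \<bullet> x \<and> a j \<bullet> x < 0}"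
      have d: "a i \<bullet> u (active a \<beta> y) j = (if i = j then 1 else 0)" if "i \<in> J" "j \<in> J" for i j
        using dual[OF y(1)] subsetD[OF y(2)] that by simp
      have vol: "measure lborel ?Q = 1 / sqrt (det_on J (\<lambda>i j. a i \<bullet> a j))" "bounded ?Q"
        by (rule halfopen_parallelepiped[OF finite True]; erule (1) d)+
      have "alpha a0 = (\<lambda>i j. a i \<bullet> a j)"
        by (intro ext) (simp add: alpha_def a_def inner_vec_def column_def)
      moreover have "\<Psi> 0 = c * measure lborel ?Q"
        using mixed_partial_top[OF \<Psi>, unfolded conjunct2[OF js]] js J len True vol(2) by simp
      ultimately show ?thesis
        using True by (simp add: vol(1) c_def)
    qed
    then show "has_iterated_partial js (phi (assoc_complex a0 b0) a0) 0 (if card J = CARD('d)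
        then 1 / ((2 * pi) powr (real CARD('d) / 2) * sqrt (det_on J (alpha a0))) else 0)"
      using iter_partial_imp_has_iterated_partial[OF \<Psi>(1), of 0] by (simp only: phi)
  qed
qed

end
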